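(* Let $k$ be a positive integer, let $G$ be a graph, and let $F$ be a forest of order $m$ with $\omega$ connected components, where $1 \le \omega \le 4$. Suppose that $\delta(G) \ge k + m - \omega$ and $k \ge \omega - 1$. (i) If $G$ is $k$-connected, then $G$ contains a subforest $F'$ isomorphic to $F$ such that $G - E(F')$ is $k$-connected. (ii) If $G$ is $k$-edge-connected, then $G$ contains a subforest $F'$ isomorphic to $F$ such that $G - E(F')$ is $k$-edge-connected.
   Context: All graphs are finite, undirected and simple. The order of a graph is its number of vertices. $\delta(G)$ is the minimum degree of $G$. A graph is $k$-connected if it has at least $k+1$ vertices and remains connected after deleting any set of fewer than $k$ vertices; it is $k$-edge-connected if it remains connected after deleting any set of fewer than $k$ edges. A subforest of $G$ is a (not necessarily induced) subgraph of $G$ that is a forest. $G - E(F')$ denotes the graph with vertex set $V(G)$ obtained by deleting the edges of $F'$ (no vertices are deleted). *)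

theory Defs
  imports "Graph_Theory.Digraph_Isomorphism"
begin

text \<open>
  A finite simple undirected graph is a \<^locale>\<open>pair_graph\<close>: a finite, loop-free, symmetric
  digraph without parallel arcs. An undirected edge between \<open>u\<close> and \<open>v\<close> is thus represented by the
  two arcs \<open>(u,v)\<close> and \<open>(v,u)\<close>. Where edges are counted or deleted, they are taken as two-element
  vertex sets, so that both arcs of an edge are treated as one edge.
\<close>

definition uedges :: "'a pair_pre_digraph \<Rightarrow> 'a set set" where
  "uedges G = (\<lambda>(u, v). {u, v}) ` parcs G"

definition delete_edges :: "'a pair_pre_digraph \<Rightarrow> 'a set set \<Rightarrow> 'a pair_pre_digraph" where
  "delete_edges G D = G\<lparr>parcs := {(u, v) \<in> parcs G. {u, v} \<notin> D}\<rparr>"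

text \<open>
  In a symmetric digraph the out-degree is the undirected degree. The value is meaningful only
  for a graph with at least one vertex.
\<close>

definition min_degree :: "'a pair_pre_digraph \<Rightarrow> nat" where
  "min_degree G = Min (out_degree G ` pverts G)"

text \<open>
  The library predicate \<^const>\<open>forest\<close> forbids directed cycles, including the cycle
  \<open>u, v, u\<close> that every edge of a symmetric digraph yields. A cycle of length at least 3
  in a \<^locale>\<open>pair_graph\<close> is exactly a cycle of the undirected graph.
\<close>

definition undirected_forest :: "'a pair_pre_digraph \<Rightarrow> bool" where
  "undirected_forest F \<longleftrightarrow>
     pair_graph F \<and> \<not> (\<exists>p. pre_digraph.cycle F p \<and> 3 \<le> length p)"

text \<open>In a symmetric digraph the strongly connected components are the connected components.\<close>

definition num_components :: "'a pair_pre_digraph \<Rightarrow> nat" where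
  "num_components G = card (pre_digraph.sccs G)"

definition subforest :: "'a pair_pre_digraph \<Rightarrow> 'a pair_pre_digraph \<Rightarrow> bool" where
  "subforest F G \<longleftrightarrow> subgraph F G \<and> undirected_forest F"

text \<open>The predicate \<^const>\<open>connected\<close> is false for the graph without vertices.\<close>

definition k_connected :: "nat \<Rightarrow> 'a pair_pre_digraph \<Rightarrow> bool" where
  "k_connected k G \<longleftrightarrow>
     k + 1 \<le> card (pverts G) \<and>
     (\<forall>S \<subseteq> pverts G. card S < k \<longrightarrow> connected (G \<restriction> (pverts G - S)))"

definition k_edge_connected :: "nat \<Rightarrow> 'a pair_pre_digraph \<Rightarrow> bool" where
  "k_edge_connected k G \<longleftrightarrow>
     (\<forall>D \<subseteq> uedges G. card D < k \<longrightarrow> connected (delete_edges G D))"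

end

theory Submission
  imports Defs "HOL-Library.List_Lexorder"
begin

text \<open>
  Deleting the edges of a copy \<open>F'\<close> of the forest can only disconnect something if a set \<open>S\<close> of
  vertices and a set \<open>M\<close> of edges with fewer than \<open>k\<close> members altogether separate the two ends of a
  deleted edge. So it suffices to find a copy such that the ends of each of its edges cannot be
  separated in this mixed sense in what remains of \<open>G\<close> (\<open>linked_transfer\<close>). This requirement is a
  local one, and it settles vertex connectivity (\<open>M\<close> empty) and edge connectivity (\<open>S\<close> empty)
  together.

  Inseparable vertices are produced by maximum adjacency orders, in which every next vertex has as
  many earlier neighbours as possible. If from some place on all vertices have at least \<open>l\<close> earlier
  neighbours, then these vertices, together with the one just before them, are pairwise
  inseparable by fewer than \<open>l\<close> vertices and edges (\<open>max_adjacency_inseparable\<close>).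

  For a single tree with \<open>t\<close> edges and minimum degree \<open>l + t\<close>, take a copy and a maximum adjacency
  order of the graph without the edges of the copy. Cut the order in front of a vertex with fewer
  than \<open>l\<close> earlier neighbours and let \<open>X\<close> be the rear part. Apart from neighbours along tree edges, a
  vertex of \<open>X\<close> has fewer than \<open>l\<close> neighbours in front of the cut, so it has more than \<open>t\<close>
  neighbours in \<open>X\<close>, less the number of tree edges that leave \<open>X\<close> there. This allows parts of the
  tree to be re-embedded in \<open>X\<close> (\<open>move_tree\<close>). Such a move adds no deleted edge in front of the
  cut or across it, so an extremal choice of copy and order leads to a tree inside a final
  interval of the required kind (\<open>tree_stage\<close>).

  The components of the forest are placed one by one, in order of decreasing size. When a
  component is to be placed, the threshold \<open>l\<close> is \<open>k\<close> plus the number of forest edges that come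
  after it, since each later edge lowers inseparability by at most one. The first component is
  already inseparable; hence the orders may begin with it, and the rear part \<open>X\<close> avoids it. The
  vertices of the other placed components are forbidden. There are more of them than edges between
  them, by the number of these components; this excess is paid for by the edges of the first component. With at most four
  components the payment falls short only for the last edge of a matching of size four, and then
  a different argument applies (\<open>extend_edge\<close>). The condition \<open>\<omega> - 1 \<le> k\<close> guarantees that the
  remaining vertices always have room for some copy of the next component.
\<close>

section \<open>Mixed separation by vertices and edges\<close>

definition neighbours :: "'a set set \<Rightarrow> 'a \<Rightarrow> 'a set" where
  "neighbours E v = {w. {v, w} \<in> E}"

definition linked :: "'a set set \<Rightarrow> 'a set \<Rightarrow> 'a set set \<Rightarrow> ('a \<times> 'a) set" where
  "linked E S M = {(x, y). {x, y} \<in> E - M \<and> x \<notin> S \<and> y \<notin> S}\<^sup>*"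

definition inseparable :: "'a set set \<Rightarrow> nat \<Rightarrow> 'a \<Rightarrow> 'a \<Rightarrow> bool" where
  "inseparable E l u v \<longleftrightarrow> (\<forall>S M. finite S \<longrightarrow> finite M \<longrightarrow> u \<notin> S \<longrightarrow> v \<notin> S \<longrightarrow>
     card S + card M < l \<longrightarrow> (u, v) \<in> linked E S M)"

lemma neighbours_mono: "E \<subseteq> E' \<Longrightarrow> neighbours E v \<subseteq> neighbours E' v"
  by (auto simp: neighbours_def)

lemma linked_sym:
  assumes "(u, v) \<in> linked E S M" shows "(v, u) \<in> linked E S M"
proof -
  have "sym {(x, y). {x, y} \<in> E - M \<and> x \<notin> S \<and> y \<notin> S}"
    by (auto simp: sym_def insert_commute)
  then have "sym (linked E S M)" unfolding linked_def by (rule sym_rtrancl)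
  then show ?thesis using assms by (rule symD)
qed

lemma linked_trans: "(u, v) \<in> linked E S M \<Longrightarrow> (v, w) \<in> linked E S M \<Longrightarrow> (u, w) \<in> linked E S M"
  unfolding linked_def by (rule rtrancl_trans)

lemma linked_cong: "(x, y) \<in> linked E S M \<Longrightarrow> (a, x) \<in> linked E S M \<longleftrightarrow> (a, y) \<in> linked E S M"
  by (metis linked_sym linked_trans)

lemma linked_edge: "{x, y} \<in> E \<Longrightarrow> {x, y} \<notin> M \<Longrightarrow> x \<notin> S \<Longrightarrow> y \<notin> S \<Longrightarrow> (x, y) \<in> linked E S M"
  unfolding linked_def by auto

text \<open>
  Mixed separators are used because of this lemma: a deleted edge simply joins the separator,
  which also works when the deleted edge joins the two vertices themselves.
\<close>

lemma inseparable_delete: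
  assumes "inseparable E (l + card D) u v" "finite D"
  shows "inseparable (E - D) l u v"
  unfolding inseparable_def
proof (intro allI impI)
  fix S :: "'a set" and M :: "'a set set"
  assume *: "finite S" "finite M" "u \<notin> S" "v \<notin> S" "card S + card M < l"
  have "card S + card (M \<union> D) < l + card D"
    using * card_Un_le[of M D] by linarith
  then have "(u, v) \<in> linked E S (M \<union> D)"
    using assms(1)[unfolded inseparable_def, rule_format, of S "M \<union> D"] assms(2) * by simp
  moreover have "linked E S (M \<union> D) = linked (E - D) S M"
    unfolding linked_def by (rule arg_cong[of _ _ rtrancl]) auto
  ultimately show "(u, v) \<in> linked (E - D) S M" by simp
qed

lemma inseparable_weaken: "inseparable E l u v \<Longrightarrow> l' \<le> l \<Longrightarrow> inseparable E l' u v"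
  unfolding inseparable_def by (meson less_le_trans)

text \<open>
  A walk that uses a lost edge is repaired by a detour, which exists because the ends of that edge
  are inseparable.
\<close>

lemma linked_transfer:
  assumes "\<And>u v. {u, v} \<in> E \<Longrightarrow> {u, v} \<notin> E' \<Longrightarrow> inseparable E' k u v"
    and "finite S" "finite M" "card S + card M < k" and "(u, v) \<in> linked E S M"
  shows "(u, v) \<in> linked E' S M"
  using assms(5) unfolding linked_def[of E]
proof (induction rule: rtrancl_induct)
  case base
  then show ?case by (simp add: linked_def)
next
  case (step y z)
  then have yz: "{y, z} \<in> E" "{y, z} \<notin> M" "y \<notin> S" "z \<notin> S" by auto
  have "(y, z) \<in> linked E' S M"
  proof (cases "{y, z} \<in> E'")
    case True
    then show ?thesis using yz by (intro linked_edge)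
  next
    case False
    then have "inseparable E' k y z" using assms(1) yz(1) by blast
    then show ?thesis using assms(2-4) yz(3,4) unfolding inseparable_def by simp
  qed
  with step(3) show ?case by (rule linked_trans)
qed

section \<open>Maximum adjacency orders\<close>

text \<open>
  The edges of \<open>M\<close> inside \<open>P\<close> and those from \<open>w\<close> to \<open>P\<close> are different edges inside \<open>insert w P\<close>.
\<close>

lemma card_edges_insert:
  assumes "finite M" "finite P" "w \<notin> P"
  shows "card {e \<in> M. e \<subseteq> P} + card {y \<in> P. {w, y} \<in> M} \<le> card {e \<in> M. e \<subseteq> insert w P}"
proof -
  let ?I = "(\<lambda>y. {w, y}) ` {y \<in> P. {w, y} \<in> M}"
  have "inj_on (\<lambda>y. {w, y}) {y \<in> P. {w, y} \<in> M}"
    using assms(3) by (auto simp: inj_on_def doubleton_eq_iff)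
  then have "card ?I = card {y \<in> P. {w, y} \<in> M}" by (rule card_image)
  moreover have "{e \<in> M. e \<subseteq> P} \<inter> ?I = {}" using assms(3) by auto
  then have "card ({e \<in> M. e \<subseteq> P} \<union> ?I) = card {e \<in> M. e \<subseteq> P} + card ?I"
    using assms by (intro card_Un_disjoint) auto
  moreover have "card ({e \<in> M. e \<subseteq> P} \<union> ?I) \<le> card {e \<in> M. e \<subseteq> insert w P}"
    using assms by (intro card_mono) auto
  ultimately show ?thesis by simp
qed

text \<open>
  The first \<open>q\<close> vertices may come in any order; this leaves room for a starting segment that is
  already known to be inseparable.
\<close>

definition max_adjacency :: "'a set set \<Rightarrow> 'a set \<Rightarrow> nat \<Rightarrow> 'a list \<Rightarrow> bool" where
  "max_adjacency E V q zs \<longleftrightarrow> (\<forall>p < length zs. q \<le> p \<longrightarrow> (\<forall>w \<in> V - set (take p zs).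
     card (neighbours E w \<inter> set (take p zs)) \<le> card (neighbours E (zs ! p) \<inter> set (take p zs))))"

text \<open>
  Suppose that \<open>S\<close> and \<open>M\<close> separate two of the vertices, into sides \<open>A\<close> and its complement, and walk
  through the order. Whenever the walk passes from one side to the other, the new vertex has at most
  as many earlier neighbours as there are separating vertices and edges seen so far: its
  neighbours since the previous change of sides are in \<open>S\<close> or reached by edges of \<open>M\<close>, and by
  maximality it has no more neighbours before that change than the vertex that was chosen there. So
  it has fewer than \<open>l\<close> earlier neighbours, and no change of sides occurs where all vertices have
  at least \<open>l\<close>. The starting segment lies on one side, whence the order in it does not matter.
\<close>

lemma max_adjacency_inseparable:
  assumes "distinct zs" "set zs = V"
    and ma: "max_adjacency E V q zs"
    and core: "\<And>u v. u \<in> set (take q zs) \<Longrightarrow> v \<in> set (take q zs) \<Longrightarrow> inseparable E l u v"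
    and high: "\<And>p. r < p \<Longrightarrow> p < length zs \<Longrightarrow> l \<le> card (neighbours E (zs ! p) \<inter> set (take p zs))"
    and ij: "r \<le> i" "i < length zs" "r \<le> j" "j < length zs"
  shows "inseparable E l (zs ! i) (zs ! j)"
  unfolding inseparable_def
proof (intro allI impI)
  fix S :: "'a set" and M :: "'a set set"
  assume fin: "finite S" "finite M" and iS: "zs ! i \<notin> S" and jS: "zs ! j \<notin> S"
    and small: "card S + card M < l"
  define A where "A = {x. (zs ! i, x) \<in> linked E S M}"
  let ?P = "\<lambda>p. set (take p zs)"
  \<comment> \<open>The last vertex before position \<open>p\<close> that is outside \<open>S\<close>, if there is one, is on the other side than \<open>w\<close>.\<close>
  define opp where "opp p w \<longleftrightarrow> (\<forall>i<p. zs ! i \<notin> S \<and> (\<forall>j. i < j \<and> j < p \<longrightarrow> zs ! j \<in> S) \<longrightarrow>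
      (zs ! i \<in> A) \<noteq> (w \<in> A))" for p w
  have cut: "{x, y} \<in> M" if "{x, y} \<in> E" "x \<notin> S" "y \<notin> S" "(x \<in> A) \<noteq> (y \<in> A)" for x y
  proof (rule ccontr)
    assume "{x, y} \<notin> M"
    then have "(x, y) \<in> linked E S M" using that(1-3) by (intro linked_edge)
    then have "(x \<in> A) = (y \<in> A)"
      unfolding A_def using linked_cong by simp
    then show False using that(4) by simp
  qed
  have P_Suc: "?P (Suc p) = insert (zs ! p) (?P p)" "zs ! p \<notin> ?P p" if "p < length zs" for p
  proof -
    show "?P (Suc p) = insert (zs ! p) (?P p)" using that by (simp add: take_Suc_conv_app_nth)
    have "distinct (take (Suc p) zs)" using assms(1) by simp
    then show "zs ! p \<notin> ?P p" using that by (simp add: take_Suc_conv_app_nth)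
  qed
  have claim: "card (neighbours E w \<inter> ?P p) \<le> card (S \<inter> ?P p) + card {e \<in> M. e \<subseteq> ?P p} + card {y \<in> ?P p. {w, y} \<in> M}"
    if "p \<le> length zs" "w \<in> V - ?P p" "w \<notin> S" "opp p w" for p w
    using that
  proof (induction p arbitrary: w)
    case 0
    then show ?case by simp
  next
    case (Suc p)
    let ?z = "zs ! p"
    have p: "p < length zs" using Suc.prems by simp
    note Ps = P_Suc[OF p]
    have w: "w \<in> V - ?P p" "w \<noteq> ?z" using Suc.prems(2) unfolding Ps(1) by auto
    have mono1: "card {e \<in> M. e \<subseteq> ?P p} \<le> card {e \<in> M. e \<subseteq> ?P (Suc p)}"
      using fin unfolding Ps(1) by (intro card_mono) auto
    show ?case
    proof (cases "?z \<in> S")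
      case True
      have "opp p w"
        unfolding opp_def
      proof (intro allI impI, elim conjE)
        fix i assume i: "i < p" "zs ! i \<notin> S" "\<forall>j. i < j \<and> j < p \<longrightarrow> zs ! j \<in> S"
        have "\<forall>j. i < j \<and> j < Suc p \<longrightarrow> zs ! j \<in> S"
          using i(3) True less_Suc_eq by auto
        then show "(zs ! i \<in> A) \<noteq> (w \<in> A)"
          using Suc.prems(4)[unfolded opp_def, rule_format, of i] i(1,2) by auto
      qed
      then have IH: "card (neighbours E w \<inter> ?P p) \<le> card (S \<inter> ?P p) + card {e \<in> M. e \<subseteq> ?P p} + card {y \<in> ?P p. {w, y} \<in> M}"
        using Suc.IH[of w] w Suc.prems p by simp
      have "card (neighbours E w \<inter> ?P (Suc p)) \<le> Suc (card (neighbours E w \<inter> ?P p))"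
        unfolding Ps(1) by (simp add: Int_insert_right card_insert_if)
      moreover have "card (S \<inter> ?P (Suc p)) = Suc (card (S \<inter> ?P p))"
        unfolding Ps(1) using True Ps(2) by (simp add: Int_insert_right card_insert_if)
      moreover have "card {y \<in> ?P p. {w, y} \<in> M} \<le> card {y \<in> ?P (Suc p). {w, y} \<in> M}"
        unfolding Ps(1) by (intro card_mono) auto
      ultimately show ?thesis using IH mono1 by linarith
    next
      case False
      then have side: "(?z \<in> A) \<noteq> (w \<in> A)"
        using Suc.prems(4) unfolding opp_def by (auto simp: less_Suc_eq)
      have edge: "?z \<in> neighbours E w \<Longrightarrow> {w, ?z} \<in> M"
        using cut[of w ?z] side Suc.prems(3) False unfolding neighbours_def by auto
      have left: "card (neighbours E w \<inter> ?P (Suc p)) = card (neighbours E w \<inter> ?P p) + (if ?z \<in> neighbours E w then 1 else 0)"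
        unfolding Ps(1) using Ps(2) by (simp add: Int_insert_right card_insert_if)
      have Seq: "S \<inter> ?P (Suc p) = S \<inter> ?P p"
        unfolding Ps(1) using False by auto
      have "{y \<in> ?P (Suc p). {w, y} \<in> M} =
          (if {w, ?z} \<in> M then insert ?z {y \<in> ?P p. {w, y} \<in> M} else {y \<in> ?P p. {w, y} \<in> M})"
        unfolding Ps(1) by auto
      then have right: "card {y \<in> ?P (Suc p). {w, y} \<in> M} =
          card {y \<in> ?P p. {w, y} \<in> M} + (if {w, ?z} \<in> M then 1 else 0)"
        using Ps(2) by (simp add: card_insert_if)
      show ?thesis
      proof (cases "opp p w")
        case True
        then have "card (neighbours E w \<inter> ?P p) \<le> card (S \<inter> ?P p) + card {e \<in> M. e \<subseteq> ?P p} + card {y \<in> ?P p. {w, y} \<in> M}"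
          using Suc.IH[of w] w Suc.prems p by simp
        then show ?thesis using left right edge mono1 Seq by (auto split: if_splits)
      next
        case False
        then obtain i0 where i0: "i0 < p" "zs ! i0 \<notin> S" "\<forall>j. i0 < j \<and> j < p \<longrightarrow> zs ! j \<in> S"
          "(zs ! i0 \<in> A) = (w \<in> A)" unfolding opp_def by blast
        have opz: "opp p ?z"
          unfolding opp_def
        proof (intro allI impI, elim conjE)
          fix i' assume i': "i' < p" "zs ! i' \<notin> S" "\<forall>j. i' < j \<and> j < p \<longrightarrow> zs ! j \<in> S"
          have "\<not> i' < i0" using i'(3) i0(1,2) by blast
          moreover have "\<not> i0 < i'" using i0(3) i'(1,2) by blast
          ultimately have "i' = i0" by simp
          then show "(zs ! i' \<in> A) \<noteq> (?z \<in> A)" using i0(4) side by auto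
        qed
        \<comment> \<open>A change of sides cannot happen inside the inseparable starting segment.\<close>
        have "q \<le> p"
        proof (rule ccontr)
          assume "\<not> q \<le> p"
          then have "p < q" by simp
          then have "zs ! i0 \<in> ?P q" "?z \<in> ?P q"
            using i0(1) p nth_mem[of i0 "take q zs"] nth_mem[of p "take q zs"] by auto
          then have "(zs ! i0, ?z) \<in> linked E S M"
            using core[of "zs ! i0" ?z] fin i0(2) \<open>?z \<notin> S\<close> small unfolding inseparable_def by simp
          then have "(zs ! i0 \<in> A) = (?z \<in> A)"
            unfolding A_def using linked_cong by simp
          then show False using i0(4) side by auto
        qed
        \<comment> \<open>Here the sides change at \<open>?z\<close>, and maximality compares \<open>w\<close> with \<open>?z\<close>.\<close>
        have "card (neighbours E w \<inter> ?P p) \<le> card (neighbours E ?z \<inter> ?P p)"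
          using ma p \<open>q \<le> p\<close> w unfolding max_adjacency_def by blast
        also have "\<dots> \<le> card (S \<inter> ?P p) + card {e \<in> M. e \<subseteq> ?P p} + card {y \<in> ?P p. {?z, y} \<in> M}"
          using Suc.IH[of ?z] opz p Ps(2) assms(2) \<open>?z \<notin> S\<close> by auto
        also have "\<dots> \<le> card (S \<inter> ?P p) + card {e \<in> M. e \<subseteq> ?P (Suc p)}"
          using card_edges_insert[OF fin(2) _ Ps(2)] unfolding Ps(1) by simp
        finally show ?thesis using left right edge Seq by (auto split: if_splits)
      qed
    qed
  qed
  show "(zs ! i, zs ! j) \<in> linked E S M"
  proof (rule ccontr)
    assume "(zs ! i, zs ! j) \<notin> linked E S M"
    then have "zs ! i \<in> A" "zs ! j \<notin> A"
      unfolding A_def by (auto simp: linked_def)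
    then have "i \<noteq> j" by auto
    obtain a b where ab: "a < b" "b < length zs" "r \<le> a" "zs ! a \<notin> S" "zs ! b \<notin> S"
      "(zs ! a \<in> A) \<noteq> (zs ! b \<in> A)"
    proof (cases "i < j")
      case True
      then show ?thesis using that[of i j] ij iS jS \<open>zs ! i \<in> A\<close> \<open>zs ! j \<notin> A\<close> by simp
    next
      case False
      then show ?thesis
        using that[of j i] ij iS jS \<open>zs ! i \<in> A\<close> \<open>zs ! j \<notin> A\<close> \<open>i \<noteq> j\<close> by simp
    qed
    define c where "c = (LEAST n. a < n \<and> zs ! n \<notin> S \<and> (zs ! n \<in> A) \<noteq> (zs ! a \<in> A))"
    have c: "a < c" "zs ! c \<notin> S" "(zs ! c \<in> A) \<noteq> (zs ! a \<in> A)" "c \<le> b"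
      using LeastI[of "\<lambda>n. a < n \<and> zs ! n \<notin> S \<and> (zs ! n \<in> A) \<noteq> (zs ! a \<in> A)" b]
        Least_le[of "\<lambda>n. a < n \<and> zs ! n \<notin> S \<and> (zs ! n \<in> A) \<noteq> (zs ! a \<in> A)" b] ab
      unfolding c_def by auto
    have cmin: "(zs ! n \<in> A) = (zs ! a \<in> A)" if "a < n" "n < c" "zs ! n \<notin> S" for n
      using not_less_Least[of n "\<lambda>n. a < n \<and> zs ! n \<notin> S \<and> (zs ! n \<in> A) \<noteq> (zs ! a \<in> A)"] that
      unfolding c_def by blast
    have clen: "c < length zs" using c ab by simp
    have "opp c (zs ! c)"
      unfolding opp_def
    proof (intro allI impI, elim conjE)
      fix i' assume i': "i' < c" "zs ! i' \<notin> S" "\<forall>j. i' < j \<and> j < c \<longrightarrow> zs ! j \<in> S"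
      have "a \<le> i'" using i'(3) c(1) ab(4) by (meson not_le)
      then show "(zs ! i' \<in> A) \<noteq> (zs ! c \<in> A)"
        using cmin[of i'] i' c by (cases "a = i'") auto
    qed
    then have "card (neighbours E (zs ! c) \<inter> ?P c) \<le>
        card (S \<inter> ?P c) + card {e \<in> M. e \<subseteq> ?P c} + card {y \<in> ?P c. {zs ! c, y} \<in> M}"
      using claim[of c "zs ! c"] clen c assms(2) P_Suc(2)[OF clen] by auto
    also have "\<dots> \<le> card (S \<inter> ?P c) + card {e \<in> M. e \<subseteq> insert (zs ! c) (?P c)}"
      using card_edges_insert[OF fin(2) _ P_Suc(2)[OF clen]] by simp
    also have "\<dots> \<le> card S + card M"
      using fin by (intro add_mono card_mono) auto
    finally show False
      using high[of c] c clen ab(3) small by simp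
  qed
qed

section \<open>Moving a tree into a part of the graph\<close>

text \<open>
  A tree with \<open>t\<close> edges is given by a parent function on the indices \<open>0, ..., t\<close> with root \<open>0\<close>, in
  which parents have smaller indices than their children.
\<close>

definition tree_copy :: "'a set set \<Rightarrow> nat \<Rightarrow> (nat \<Rightarrow> nat) \<Rightarrow> (nat \<Rightarrow> 'a) \<Rightarrow> bool" where
  "tree_copy E t par f \<longleftrightarrow> inj_on f {..t} \<and> (\<forall>i \<in> {1..t}. {f i, f (par i)} \<in> E)"

definition tree_edges :: "nat \<Rightarrow> (nat \<Rightarrow> nat) \<Rightarrow> (nat \<Rightarrow> 'a) \<Rightarrow> 'a set set" where
  "tree_edges t par f = (\<lambda>i. {f i, f (par i)}) ` {1..t}"

text \<open>
  The missing vertices are placed in increasing order of their indices, so that the parent of the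
  next one is always present.
\<close>

lemma greedy_extend:
  fixes f :: "nat \<Rightarrow> 'a"
  assumes par: "\<And>i. 1 \<le> i \<Longrightarrow> i \<le> t \<Longrightarrow> par i < i"
    and S0: "S0 \<subseteq> {..t}" "0 \<in> S0" "\<And>i. i \<in> S0 \<Longrightarrow> 1 \<le> i \<Longrightarrow> par i \<in> S0"
    and inj0: "inj_on f S0" and edges0: "\<And>i. i \<in> S0 \<Longrightarrow> 1 \<le> i \<Longrightarrow> {f i, f (par i)} \<in> E"
    and free: "\<And>S g x. S0 \<subseteq> S \<Longrightarrow> S \<subseteq> {..t} \<Longrightarrow> x \<in> {..t} - S \<Longrightarrow> par x \<in> S \<Longrightarrow> inj_on g S \<Longrightarrow>
        (\<And>i. i \<in> S0 \<Longrightarrow> g i = f i) \<Longrightarrow> g ` (S - S0) \<subseteq> W \<Longrightarrow> \<exists>w \<in> W - g ` S. {w, g (par x)} \<in> E"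
  shows "\<exists>g. tree_copy E t par g \<and> (\<forall>i \<in> S0. g i = f i) \<and> g ` ({..t} - S0) \<subseteq> W"
proof -
  have claim: "\<exists>g. tree_copy E t par g \<and> (\<forall>i \<in> S0. g i = f i) \<and> g ` ({..t} - S0) \<subseteq> W"
    if "S0 \<subseteq> S" "S \<subseteq> {..t}" "\<And>i. i \<in> S \<Longrightarrow> 1 \<le> i \<Longrightarrow> par i \<in> S" "inj_on g S"
      "\<And>i. i \<in> S \<Longrightarrow> 1 \<le> i \<Longrightarrow> {g i, g (par i)} \<in> E"
      "\<And>i. i \<in> S0 \<Longrightarrow> g i = f i" "g ` (S - S0) \<subseteq> W" for S and g :: "nat \<Rightarrow> 'a"
    using that
  proof (induction "card ({..t} - S)" arbitrary: S g rule: less_induct)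
    case less
    show ?case
    proof (cases "S = {..t}")
      case True
      then show ?thesis
        using less.prems(4-7) unfolding tree_copy_def by (intro exI[of _ g] conjI) simp_all
    next
      case False
      define x where "x = (LEAST i. i \<in> {..t} - S)"
      have ex: "\<exists>i. i \<in> {..t} - S" using False less.prems(2) by auto
      have x: "x \<in> {..t} - S" unfolding x_def using LeastI_ex[OF ex] .
      have xmin: "i \<in> S" if "i < x" for i
        using not_less_Least[of i "\<lambda>i. i \<in> {..t} - S"] that x unfolding x_def by auto
      have x1: "1 \<le> x" using x S0(2) less.prems(1) by (cases x) auto
      have px: "par x \<in> S" using par[OF x1] x xmin by auto
      obtain w where w: "w \<in> W - g ` S" "{w, g (par x)} \<in> E"
        using free[OF less.prems(1,2) x px less.prems(4,6,7)] by blast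
      let ?g = "g(x := w)" let ?S = "insert x S"
      have xS: "x \<notin> S" using x by simp
      have same: "?g i = g i" if "i \<in> S" for i using that xS by auto
      show ?thesis
      proof (rule less.hyps[of ?S ?g])
        show "card ({..t} - ?S) < card ({..t} - S)"
          using x by (intro psubset_card_mono) auto
        show "S0 \<subseteq> ?S" "?S \<subseteq> {..t}" using less.prems(1,2) x by auto
        show "\<And>i. i \<in> ?S \<Longrightarrow> 1 \<le> i \<Longrightarrow> par i \<in> ?S" using less.prems(3) px by auto
        have "inj_on ?g S" using less.prems(4) same by (simp add: inj_on_def)
        then show "inj_on ?g ?S" using w(1) xS same by auto
        show "{?g i, ?g (par i)} \<in> E" if "i \<in> ?S" "1 \<le> i" for i
        proof (cases "i = x")
          case True
          then show ?thesis using w(2) px same[of "par x"] by simp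
        next
          case False
          then have "i \<in> S" using that by simp
          then show ?thesis using less.prems(3,5)[of i] that(2) same by simp
        qed
        show "\<And>i. i \<in> S0 \<Longrightarrow> ?g i = f i" using less.prems(1,6) xS by auto
        show "?g ` (?S - S0) \<subseteq> W" using less.prems(7) w(1) by auto
      qed
    qed
  qed
  show ?thesis by (rule claim[of S0 f]) (simp_all add: S0 inj0 edges0)
qed

lemma greedy_embed:
  assumes par: "\<And>i. 1 \<le> i \<Longrightarrow> i \<le> t \<Longrightarrow> par i < i"
    and "finite W" "W \<noteq> {}" and loopfree: "\<And>v. v \<notin> neighbours E v"
    and deg: "\<And>v. v \<in> W \<Longrightarrow> t \<le> card (neighbours E v \<inter> W)"
  shows "\<exists>f. tree_copy E t par f \<and> f ` {..t} \<subseteq> W"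
proof -
  obtain w0 where w0: "w0 \<in> W" using assms(3) by auto
  have "\<exists>g. tree_copy E t par g \<and> (\<forall>i \<in> {0}. g i = w0) \<and> g ` ({..t} - {0}) \<subseteq> W"
  proof (rule greedy_extend[OF par, of t "{0}" "\<lambda>_. w0"])
    fix S x and g :: "nat \<Rightarrow> 'a"
    assume *: "{0} \<subseteq> S" "S \<subseteq> {..t}" "x \<in> {..t} - S" "par x \<in> S" "inj_on g S"
      "\<And>i. i \<in> {0} \<Longrightarrow> g i = w0" "g ` (S - {0}) \<subseteq> W"
    let ?z = "g (par x)"
    have finS: "finite S" using *(2) finite_subset by blast
    have "g 0 = w0" using *(6) by simp
    then have SW: "g ` S \<subseteq> W" using *(1,7) w0 by blast
    have "S \<subset> {..t}" using *(2,3) by auto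
    then have "card S < card {..t}" by (intro psubset_card_mono) auto
    then have "card S \<le> t" by simp
    moreover have "0 < card S" using *(1) finS by (auto simp: card_gt_0_iff)
    ultimately have "card (g ` S - {?z}) < t"
      using *(4,5) finS by (simp add: card_image card_Diff_singleton)
    also have "t \<le> card (neighbours E ?z \<inter> W)" using deg SW *(4) by auto
    finally have "\<not> neighbours E ?z \<inter> W \<subseteq> g ` S - {?z}"
      using finS by (meson card_mono finite_Diff finite_imageI not_less)
    then obtain w where "w \<in> neighbours E ?z \<inter> W" "w \<notin> g ` S - {?z}" by blast
    then show "\<exists>w \<in> W - g ` S. {w, ?z} \<in> E"
      using loopfree[of ?z] by (intro bexI[of _ w]) (auto simp: neighbours_def insert_commute)
  qed (use par in auto)
  then obtain g where g: "tree_copy E t par g" "g 0 = w0" "g ` ({..t} - {0}) \<subseteq> W" by blast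
  then have "g ` {..t} \<subseteq> W" using w0 by fastforce
  then show ?thesis using g(1) by blast
qed

lemma tree_edges_subset:
  assumes "\<And>i. 1 \<le> i \<Longrightarrow> i \<le> t \<Longrightarrow> par i < i" "e \<in> tree_edges t par f"
  shows "e \<subseteq> f ` {..t}"
proof -
  obtain j where "j \<in> {1..t}" "e = {f j, f (par j)}" using assms(2) unfolding tree_edges_def by auto
  moreover have "par j \<le> t" using assms(1)[of j] calculation(1) by auto
  ultimately show ?thesis by auto
qed

text \<open>
  Let \<open>\<alpha> v\<close> be the number of tree edges that lead from \<open>v\<close> out of \<open>X\<close>. By the degree condition a
  vertex \<open>v\<close> of \<open>X\<close> has at least \<open>t + 1 - \<alpha> v\<close> neighbours in \<open>X - Q\<close>. If \<open>\<alpha> \<le> 1\<close> on \<open>X\<close>, this is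
  enough to embed the whole tree greedily in \<open>X - Q\<close>. Otherwise let \<open>i\<close> be the largest index with
  \<open>\<alpha> (f i) \<ge> 2\<close>. One of the tree edges that leave \<open>X\<close> at \<open>f i\<close> leads to a child \<open>j\<close>, and the
  subtree below \<open>j\<close> is embedded anew in \<open>X - Q\<close>. It is attached to \<open>f i\<close>, whose other \<open>\<alpha> (f i) - 1\<close>
  tree neighbours outside \<open>X\<close> stay there and do not occupy vertices of \<open>X\<close>. The vertices of
  \<open>X\<close> used below \<open>j\<close>, old or new, have \<open>\<alpha> \<le> 1\<close>, so the rest of the subtree meets no obstacle.
\<close>

lemma move_tree:
  fixes f :: "nat \<Rightarrow> 'a"
  assumes par: "\<And>i. 1 \<le> i \<Longrightarrow> i \<le> t \<Longrightarrow> par i < i"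
    and V: "finite V" "\<And>v. neighbours E v \<subseteq> V" and loopfree: "\<And>v. v \<notin> neighbours E v"
    and f: "tree_copy E t par f" and fQ: "f ` {..t} \<inter> Q = {}"
    and X: "X \<noteq> {}" "X \<subseteq> V"
    and deg: "\<And>v. v \<in> X \<Longrightarrow> l + t \<le> card (neighbours E v - Q)"
    and closed: "\<And>v. v \<in> X \<Longrightarrow> card (neighbours (E - tree_edges t par f) v - X) < l"
    and out: "\<not> f ` {..t} \<subseteq> X"
  shows "\<exists>g. tree_copy E t par g \<and> g ` {..t} \<subseteq> f ` {..t} \<union> (X - Q) \<and>
    tree_edges t par g \<subseteq> tree_edges t par f \<union> {e. e \<subseteq> X} \<and>
    card {i \<in> {..t}. g i \<notin> X} < card {i \<in> {..t}. f i \<notin> X}"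
proof -
  let ?T = "tree_edges t par f"
  define \<alpha> where "\<alpha> v = card (neighbours ?T v - X)" for v
  let ?W = "X - Q"
  have finX: "finite X" using X V finite_subset by blast
  have finnb: "finite (neighbours E v)" for v using V finite_subset by blast
  have TE: "?T \<subseteq> E" using f unfolding tree_copy_def tree_edges_def by auto
  have finT: "finite (neighbours ?T v)" for v using finnb neighbours_mono[OF TE] finite_subset by blast
  have inside: "t + 1 \<le> card (neighbours E v \<inter> ?W) + \<alpha> v" if "v \<in> X" for v
  proof -
    have "neighbours E v - Q \<subseteq> (neighbours E v \<inter> ?W) \<union> (neighbours (E - ?T) v - X) \<union> (neighbours ?T v - X)"
      by (auto simp: neighbours_def)
    moreover have "finite (neighbours (E - ?T) v)" using finnb neighbours_mono[of "E - ?T" E] finite_subset by blast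
    ultimately have "card (neighbours E v - Q) \<le> card ((neighbours E v \<inter> ?W) \<union> (neighbours (E - ?T) v - X) \<union> (neighbours ?T v - X))"
      using finX finT by (intro card_mono) auto
    also have "\<dots> \<le> card (neighbours E v \<inter> ?W) + card (neighbours (E - ?T) v - X) + card (neighbours ?T v - X)"
      using card_Un_le[of "(neighbours E v \<inter> ?W) \<union> (neighbours (E - ?T) v - X)" "neighbours ?T v - X"]
        card_Un_le[of "neighbours E v \<inter> ?W" "neighbours (E - ?T) v - X"] by linarith
    finally show ?thesis using deg[OF that] closed[OF that] unfolding \<alpha>_def by linarith
  qed
  have \<alpha>0: "\<alpha> v = 0" if "v \<notin> f ` {..t}" for v
  proof -
    have "neighbours ?T v = {}" using tree_edges_subset[OF par, of t _ f] that by (auto simp: neighbours_def)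
    then show ?thesis by (simp add: \<alpha>_def)
  qed
  show ?thesis
  proof (cases "\<forall>v \<in> X. \<alpha> v \<le> 1")
    case True
    have "?W \<noteq> {}"
    proof
      assume e: "?W = {}"
      obtain v where v: "v \<in> X" using X by auto
      then have "v \<notin> f ` {..t}" using e fQ by auto
      then show False using inside[OF v] \<alpha>0 e by simp
    qed
    moreover have "t \<le> card (neighbours E v \<inter> ?W)" if "v \<in> ?W" for v
      using inside[of v] True that by fastforce
    ultimately obtain g where g: "tree_copy E t par g" "g ` {..t} \<subseteq> ?W"
      using greedy_embed[OF par _ _ loopfree, of t ?W] finX by blast
    have "tree_edges t par g \<subseteq> {e. e \<subseteq> X}"
      using tree_edges_subset[OF par, of t _ g] g(2) by blast
    moreover have "card {i \<in> {..t}. g i \<notin> X} = 0"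
    proof -
      have "{i \<in> {..t}. g i \<notin> X} = {}" using g(2) by auto
      then show ?thesis by (simp only: card.empty)
    qed
    moreover have "0 < card {i \<in> {..t}. f i \<notin> X}"
      using out by (auto simp: card_gt_0_iff)
    ultimately have "tree_edges t par g \<subseteq> ?T \<union> {e. e \<subseteq> X}"
      "card {i \<in> {..t}. g i \<notin> X} < card {i \<in> {..t}. f i \<notin> X}" by (blast, simp only:)
    then show ?thesis using g by blast
  next
    case False
    then obtain v where v: "v \<in> X" "2 \<le> \<alpha> v" by auto
    then obtain i0 where i0: "i0 \<le> t" "v = f i0" using \<alpha>0[of v] by (cases "v \<in> f ` {..t}") auto
    define B where "B = {i \<in> {..t}. f i \<in> X \<and> 2 \<le> \<alpha> (f i)}"
    have B: "finite B" "B \<noteq> {}" using i0 v unfolding B_def by auto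
    define i where "i = Max B"
    have "i \<in> B" unfolding i_def using Max_in B by blast
    then have i: "i \<le> t" "f i \<in> X" "2 \<le> \<alpha> (f i)" unfolding B_def by auto
    have imax: "\<alpha> (f y) \<le> 1" if "i < y" "y \<le> t" "f y \<in> X" for y
    proof (rule ccontr)
      assume "\<not> \<alpha> (f y) \<le> 1"
      then have "y \<in> B" using that unfolding B_def by auto
      then have "y \<le> i" unfolding i_def using B(1) by simp
      then show False using that(1) by simp
    qed
    have inj: "inj_on f {..t}" using f unfolding tree_copy_def by simp
    have nbi: "\<exists>j. w = f j \<and> j \<le> t \<and> (1 \<le> i \<and> j = par i \<or> 1 \<le> j \<and> par j = i)" if w: "w \<in> neighbours ?T (f i)" for w
    proof -
      obtain j where j: "j \<in> {1..t}" "{f i, w} = {f j, f (par j)}"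
        using w unfolding neighbours_def tree_edges_def by auto
      have pj: "par j < j" "par j \<le> t" using par[of j] j(1) by auto
      consider "f i = f j" "w = f (par j)" | "f i = f (par j)" "w = f j"
        using j(2) by (auto simp: doubleton_eq_iff)
      then show ?thesis
      proof cases
        case 1
        then have "i = j" using inj_onD[OF inj, of i j] i(1) j(1) by auto
        then show ?thesis using 1 j(1) pj by (intro exI[of _ "par j"]) auto
      next
        case 2
        then have "i = par j" using inj_onD[OF inj, of i "par j"] i(1) pj by auto
        then show ?thesis using 2 j(1) by (intro exI[of _ j]) auto
      qed
    qed
    have "\<exists>w \<in> neighbours ?T (f i) - X. w \<noteq> f (par i)"
    proof (rule ccontr)
      assume "\<not> ?thesis"
      then have "neighbours ?T (f i) - X \<subseteq> {f (par i)}" by auto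
      then have "\<alpha> (f i) \<le> 1" unfolding \<alpha>_def using card_mono[of "{f (par i)}"] by fastforce
      then show False using i by simp
    qed
    then obtain j where j: "1 \<le> j" "j \<le> t" "par j = i" "f j \<notin> X" using nbi by blast
    have ij: "i < j" using par[of j] j by simp
    define R where "R = {(x, par x) | x. 1 \<le> x \<and> x \<le> t}"
    \<comment> \<open>The indices of the subtree below \<open>j\<close>; their copies are given up.\<close>
    define D where "D = {x \<in> {..t}. (x, j) \<in> R\<^sup>*}"
    have jD: "j \<in> D" using j unfolding D_def by auto
    have Dge: "j \<le> x" if "x \<in> D" for x
    proof -
      have "(x, j) \<in> R\<^sup>*" using that unfolding D_def by simp
      then show ?thesis
      proof (induction rule: converse_rtrancl_induct)
        case (step y z)
        then have "z < y" unfolding R_def using par by auto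
        then show ?case using step by simp
      qed simp
    qed
    have Dpar: "par x \<in> D" if x: "x \<in> D" "x \<noteq> j" for x
    proof -
      have "(x, j) \<in> R\<^sup>*" using x unfolding D_def by simp
      then obtain y where y: "(x, y) \<in> R" "(y, j) \<in> R\<^sup>*" using x(2) by (auto elim: converse_rtranclE)
      then have "y = par x" "1 \<le> x" "x \<le> t" unfolding R_def by auto
      then show ?thesis using y(2) par[of x] unfolding D_def by auto
    qed
    have parD: "x \<in> D" if "1 \<le> x" "x \<le> t" "par x \<in> D" for x
    proof -
      have "(x, par x) \<in> R" using that unfolding R_def by auto
      then show ?thesis using that unfolding D_def by (auto intro: converse_rtrancl_into_rtrancl)
    qed
    let ?S0 = "{..t} - D"
    have "\<exists>g. tree_copy E t par g \<and> (\<forall>i \<in> ?S0. g i = f i) \<and> g ` ({..t} - ?S0) \<subseteq> ?W"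
    proof (rule greedy_extend[OF par, of t ?S0 f])
      show "0 \<in> ?S0" using Dge[of 0] j by auto
      show "par x \<in> ?S0" if "x \<in> ?S0" "1 \<le> x" for x
        using that parD[of x] par[of x] by auto
      show "inj_on f ?S0" using inj by (rule inj_on_subset) auto
      show "{f x, f (par x)} \<in> E" if "x \<in> ?S0" "1 \<le> x" for x
        using f that unfolding tree_copy_def by auto
      fix S x and g :: "nat \<Rightarrow> 'a"
      assume *: "?S0 \<subseteq> S" "S \<subseteq> {..t}" "x \<in> {..t} - S" "par x \<in> S" "inj_on g S"
        "\<And>i. i \<in> ?S0 \<Longrightarrow> g i = f i" "g ` (S - ?S0) \<subseteq> ?W"
      let ?z = "g (par x)"
      have finS: "finite S" using *(2) finite_subset by blast
      have "S \<subset> {..t}" using *(2,3) by auto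
      then have "card S < card {..t}" by (intro psubset_card_mono) auto
      then have cS: "card S \<le> t" by simp
      have cS0: "0 < card S" using *(4) finS by (auto simp: card_gt_0_iff)
      have cgS: "card (g ` S - {?z}) = card S - 1"
        using *(4,5) finS by (simp add: card_image card_Diff_singleton)
      have xD: "x \<in> D" using *(1,3) by auto
      have "card ((g ` S - {?z}) \<inter> ?W) < card (neighbours E ?z \<inter> ?W)"
      proof (cases "par x \<in> ?S0")
        case True
        then have "x = j" using Dpar[OF xD] by auto
        then have pxi: "par x = i" using j by simp
        then have z: "?z = f i" using *(6) True by simp
        \<comment> \<open>The kept tree neighbours of \<open>f i\<close> outside \<open>X\<close>: they count in \<open>S\<close> but occupy nothing in \<open>X\<close>.\<close>
        let ?N = "neighbours ?T (f i) - X - {f j}"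
        have N: "?N \<subseteq> g ` S - {?z}"
        proof
          fix w assume w: "w \<in> ?N"
          then obtain j' where j': "w = f j'" "j' \<le> t" "1 \<le> i \<and> j' = par i \<or> 1 \<le> j' \<and> par j' = i"
            using nbi[of w] by blast
          have "j' \<noteq> j" using w j' by auto
          have iD: "i \<notin> D" using Dge[of i] ij by auto
          have "j' \<notin> D"
          proof
            assume "j' \<in> D"
            then have "par j' \<in> D" "j \<le> j'" using Dpar \<open>j' \<noteq> j\<close> Dge by auto
            then show False using j'(3) iD ij par[of i] i(1) by auto
          qed
          then have "g j' = f j'" "j' \<in> S" using *(1,6) j'(2) by auto
          then have "w \<in> g ` S" using j'(1) by (metis imageI)
          moreover have "w \<noteq> ?z" using w z i(2) by auto
          ultimately show "w \<in> g ` S - {?z}" by simp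
        qed
        have "\<alpha> (f i) \<le> card ?N + 1"
        proof -
          have "neighbours ?T (f i) - X \<subseteq> {f j} \<union> ?N" by auto
          then have "\<alpha> (f i) \<le> card ({f j} \<union> ?N)"
            unfolding \<alpha>_def using finT by (intro card_mono) auto
          also have "\<dots> \<le> card {f j} + card ?N" by (rule card_Un_le)
          finally show ?thesis by simp
        qed
        moreover have "card ((g ` S - {?z}) \<inter> ?W) + card ?N \<le> card (g ` S - {?z})"
        proof -
          have "card ((g ` S - {?z}) \<inter> ?W) + card ?N = card (((g ` S - {?z}) \<inter> ?W) \<union> ?N)"
            using finS finT by (intro card_Un_disjoint[symmetric]) auto
          also have "\<dots> \<le> card (g ` S - {?z})" using N finS by (intro card_mono) auto
          finally show ?thesis .
        qed
        ultimately show ?thesis using inside[OF i(2)] cgS cS cS0 z by simp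
      next
        case False
        then have zW: "?z \<in> ?W" using *(4,7) by blast
        have "\<alpha> ?z \<le> 1"
        proof (cases "?z \<in> f ` {..t}")
          case True
          then obtain y where y: "y \<le> t" "?z = f y" by auto
          have "y \<in> D"
          proof (rule ccontr)
            assume "y \<notin> D"
            then have "y \<in> ?S0" using y by auto
            then have "g y = ?z" "y \<in> S" using *(1,6) y by auto
            then have "y = par x" using *(4,5) by (auto dest: inj_onD)
            then show False using False \<open>y \<in> ?S0\<close> by simp
          qed
          then show ?thesis using imax[of y] Dge[of y] ij y zW by auto
        next
          case False
          then show ?thesis using \<alpha>0 by simp
        qed
        then have "t \<le> card (neighbours E ?z \<inter> ?W)" using inside[of ?z] zW by simp
        moreover have "card ((g ` S - {?z}) \<inter> ?W) \<le> card (g ` S - {?z})"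
          using finS by (intro card_mono) auto
        ultimately show ?thesis using cgS cS cS0 by simp
      qed
      then have "\<not> neighbours E ?z \<inter> ?W \<subseteq> (g ` S - {?z}) \<inter> ?W"
        using finS by (meson card_mono finite_Diff finite_Int finite_imageI not_less)
      then obtain w where "w \<in> neighbours E ?z \<inter> ?W" "w \<notin> g ` S - {?z}" by blast
      then show "\<exists>w \<in> ?W - g ` S. {w, ?z} \<in> E"
        using loopfree[of ?z] by (intro bexI[of _ w]) (auto simp: neighbours_def insert_commute)
    qed (use par in auto)
    then obtain g where g: "tree_copy E t par g" "\<And>x. x \<in> ?S0 \<Longrightarrow> g x = f x" "g ` ({..t} - ?S0) \<subseteq> ?W" by blast
    have Dt: "{..t} - ?S0 = D" unfolding D_def by auto
    have gD: "g x \<in> ?W" if "x \<in> D" for x using g(3) that unfolding Dt by auto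
    have "g ` {..t} \<subseteq> f ` {..t} \<union> ?W"
    proof
      fix w assume "w \<in> g ` {..t}"
      then obtain x where x: "x \<le> t" "w = g x" by auto
      show "w \<in> f ` {..t} \<union> ?W"
        using x gD[of x] g(2)[of x] by (cases "x \<in> D") auto
    qed
    moreover have "tree_edges t par g \<subseteq> ?T \<union> {e. e \<subseteq> X}"
    proof
      fix e assume "e \<in> tree_edges t par g"
      then obtain x where x: "1 \<le> x" "x \<le> t" "e = {g x, g (par x)}"
        unfolding tree_edges_def by auto
      have px: "par x \<le> t" using par[of x] x by simp
      show "e \<in> ?T \<union> {e. e \<subseteq> X}"
      proof (cases "x \<in> D")
        case True
        then have "g x \<in> X" using gD by auto
        moreover have "g (par x) \<in> X"
        proof (cases "x = j")
          case True
          then have "par x \<in> ?S0" using j Dge[of i] ij i by auto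
          then show ?thesis using g(2) True j(3) i(2) by auto
        next
          case False
          then show ?thesis using Dpar[OF \<open>x \<in> D\<close>] gD by auto
        qed
        ultimately show ?thesis using x(3) by auto
      next
        case False
        then have "par x \<notin> D" using parD x by blast
        then have "e = {f x, f (par x)}" using x(2,3) px False g(2) by auto
        then show ?thesis using x unfolding tree_edges_def by auto
      qed
    qed
    moreover have "card {i \<in> {..t}. g i \<notin> X} < card {i \<in> {..t}. f i \<notin> X}"
    proof (rule psubset_card_mono)
      have "x \<in> {i \<in> {..t}. f i \<notin> X}" if "x \<in> {i \<in> {..t}. g i \<notin> X}" for x
        using that gD[of x] g(2)[of x] by (cases "x \<in> D") auto
      moreover have "j \<notin> {i \<in> {..t}. g i \<notin> X}" using gD[OF jD] by auto
      moreover have "j \<in> {i \<in> {..t}. f i \<notin> X}" using j by auto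
      ultimately show "{i \<in> {..t}. g i \<notin> X} \<subset> {i \<in> {..t}. f i \<notin> X}" by blast
    qed simp
    ultimately show ?thesis using g(1) by blast
  qed
qed

section \<open>Placing one tree\<close>

definition back_degrees :: "'a set set \<Rightarrow> 'a set \<Rightarrow> 'a list \<Rightarrow> nat list" where
  "back_degrees E Y ws = map (\<lambda>i. card (neighbours E (ws ! i) \<inter> (Y \<union> set (take i ws)))) [0..<length ws]"

lemma less_list_nthI:
  fixes b c :: "nat list"
  assumes "length b = length c" "j < length b" "\<And>i. i < j \<Longrightarrow> b ! i = c ! i" "b ! j < c ! j"
  shows "b < c"
proof -
  have "take j b = take j c"
    using assms(1-3) by (intro nth_equalityI) auto
  then show ?thesis
    unfolding list_less_def lexord_take_index_conv using assms by auto
qed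

text \<open>
  Here \<open>Q\<close> is the inseparable starting segment, \<open>U\<close> the set of vertices that the tree may use, and
  \<open>move\<close> the assumption that a copy can be pushed into any set \<open>X\<close> whose vertices keep fewer than
  \<open>l\<close> neighbours outside. Consider the longest initial segment \<open>ys\<close> of a maximum adjacency order
  that leaves room for a copy behind it, and among all such copies and all continuations \<open>ws\<close> of the
  order choose a pair for which the list of numbers of earlier neighbours is lexicographically
  largest. If this list has an entry below \<open>l\<close> after its first one, cut the order there. Moving the
  copy behind the cut can only increase the entries up to the cut, hence by maximality does not
  change them; so \<open>ys\<close> could have been continued up to the cut. Therefore all entries but the first
  are at least \<open>l\<close>, and the copy lies in an inseparable final interval.
\<close>

lemma tree_stage:
  fixes E :: "'a set set"
  assumes par: "\<And>i. 1 \<le> i \<Longrightarrow> i \<le> t \<Longrightarrow> par i < i"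
    and V: "finite V" "\<And>v. neighbours E v \<subseteq> V"
    and Q: "Q \<subseteq> V" "U \<subseteq> V - Q"
    and ex: "\<exists>f. tree_copy E t par f \<and> f ` {..t} \<subseteq> U"
    and core: "\<And>f u v. tree_copy E t par f \<Longrightarrow> f ` {..t} \<subseteq> U \<Longrightarrow> u \<in> Q \<Longrightarrow> v \<in> Q \<Longrightarrow>
      inseparable (E - tree_edges t par f) l u v"
    and move: "\<And>X f. X \<noteq> {} \<Longrightarrow> X \<subseteq> V - Q \<Longrightarrow> tree_copy E t par f \<Longrightarrow> f ` {..t} \<subseteq> U \<Longrightarrow>
      (\<And>v. v \<in> X \<Longrightarrow> card (neighbours (E - tree_edges t par f) v - X) < l) \<Longrightarrow> \<not> f ` {..t} \<subseteq> X \<Longrightarrow>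
      \<exists>g. tree_copy E t par g \<and> g ` {..t} \<subseteq> U \<inter> (f ` {..t} \<union> X) \<and>
        tree_edges t par g \<subseteq> tree_edges t par f \<union> {e. e \<subseteq> X} \<and>
        card {i \<in> {..t}. g i \<notin> X} < card {i \<in> {..t}. f i \<notin> X}"
  shows "\<exists>f. tree_copy E t par f \<and> f ` {..t} \<subseteq> U \<and>
    (\<forall>i \<le> t. \<forall>j \<le> t. inseparable (E - tree_edges t par f) l (f i) (f j))"
proof -
  let ?T = "tree_edges t par"
  let ?copy = "\<lambda>f W. tree_copy E t par f \<and> f ` {..t} \<subseteq> W"
  have "finite Q" using Q(1) V(1) by (rule finite_subset)
  then obtain qs where qs: "set qs = Q" "distinct qs" using finite_distinct_list by blast
  define ok where "ok ys \<longleftrightarrow> distinct ys \<and> set ys \<subseteq> V \<and> take (length qs) ys = qs \<and>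
    max_adjacency E V (length qs) ys \<and> (\<exists>f. ?copy f (U - set ys))" for ys
  have ok_qs: "ok qs"
  proof -
    obtain f where "?copy f U" using ex by blast
    moreover have "U - set qs = U" using Q(2) qs(1) by blast
    ultimately show ?thesis
      unfolding ok_def max_adjacency_def using qs Q(1) by auto
  qed
  have bound: "length ys \<le> card V" if "ok ys" for ys
  proof -
    have "length ys = card (set ys)" using that distinct_card[of ys] unfolding ok_def by simp
    also have "\<dots> \<le> card V" using that V(1) unfolding ok_def by (intro card_mono) auto
    finally show ?thesis .
  qed
  have "\<exists>ys. ok ys \<and> (\<forall>ys'. ok ys' \<longrightarrow> length ys' \<le> length ys)"
    using ok_qs bound by (intro ex_has_greatest_nat[of ok qs length "Suc (card V)"]) (simp_all add: less_Suc_eq_le)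
  then obtain ys where ys: "ok ys" "\<And>ys'. ok ys' \<Longrightarrow> length ys' \<le> length ys" by blast
  note okD = ys(1)[unfolded ok_def]
  define X0 where "X0 = V - set ys"
  have qlen: "length qs \<le> length ys" using okD length_take[of "length qs" ys] by simp
  have Qys: "Q \<subseteq> set ys" using okD qs(1) set_take_subset[of "length qs" ys] by simp
  define P where "P = {(f, ws). ?copy f (U - set ys) \<and> distinct ws \<and> set ws = X0}"
  define bd where "bd f ws = back_degrees (E - ?T f) (set ys) ws" for f ws
  let ?H = "\<lambda>f. E - ?T f"
  have finX0: "finite X0" unfolding X0_def using V by simp
  have lenws: "length ws = card X0" if "(f, ws) \<in> P" for f ws
    using that distinct_card unfolding P_def by fastforce
  have lenbd: "length (bd f ws) = card X0" if "(f, ws) \<in> P" for f ws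
    using lenws[OF that] unfolding bd_def back_degrees_def by simp
  have bd_nth: "bd f ws ! i = card (neighbours (?H f) (ws ! i) \<inter> (set ys \<union> set (take i ws)))"
    if "i < length ws" for f ws i
    using that unfolding bd_def back_degrees_def by simp
  obtain f0 where f0: "?copy f0 (U - set ys)" using okD by blast
  obtain ws0 where ws0: "set ws0 = X0" "distinct ws0" using finite_distinct_list[OF finX0] by blast
  have P0: "(f0, ws0) \<in> P" unfolding P_def using f0 ws0 by simp
  let ?B = "(\<lambda>(f, ws). bd f ws) ` P"
  have "?B \<subseteq> {xs. set xs \<subseteq> {..card V} \<and> length xs = card X0}"
  proof
    fix b assume "b \<in> ?B"
    then obtain f ws where p: "(f, ws) \<in> P" "b = bd f ws" by auto
    have "card (neighbours (?H f) (ws ! i) \<inter> (set ys \<union> set (take i ws))) \<le> card V" for i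
      using V neighbours_mono[of "?H f" E] by (intro card_mono) blast+
    then show "b \<in> {xs. set xs \<subseteq> {..card V} \<and> length xs = card X0}"
      using lenbd[OF p(1)] p(2) unfolding bd_def back_degrees_def by auto
  qed
  then have finB: "finite ?B"
    by (rule finite_subset) (simp add: finite_lists_length_eq)
  have "?B \<noteq> {}" using P0 by auto
  then have "Max ?B \<in> ?B" using Max_in finB by blast
  then obtain f1 ws where P1: "(f1, ws) \<in> P" and b: "bd f1 ws = Max ?B" by auto
  define b where "b = bd f1 ws"
  have ws: "distinct ws" "set ws = X0" using P1 unfolding P_def by auto
  have lenb: "length b = card X0" "length ws = card X0" unfolding b_def using lenbd lenws P1 by auto
  have LEX: "bd f ws' ! j \<le> b ! j"
    if "(f, ws') \<in> P" "j < card X0" "\<And>i. i < j \<Longrightarrow> bd f ws' ! i = b ! i" for f ws' j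
  proof (rule ccontr)
    assume "\<not> ?thesis"
    then have "b < bd f ws'"
      using that lenbd[OF that(1)] lenb by (intro less_list_nthI[of _ _ j]) auto
    moreover have "bd f ws' \<le> b"
      unfolding b_def b using finB that(1) by (intro Max_ge) auto
    ultimately show False by simp
  qed
  have PW: "bd f ws' ! i = b ! i"
    if p: "(f, ws') \<in> P" and "j < card X0" "\<And>i. i \<le> j \<Longrightarrow> b ! i \<le> bd f ws' ! i" "i \<le> j" for f ws' i j
    using that(4)
  proof (induction i rule: less_induct)
    case (less i)
    then have "bd f ws' ! i \<le> b ! i" using that by (intro LEX[OF p]) auto
    then show ?case using that(3)[of i] less by simp
  qed
  \<comment> \<open>Lexicographic maximality makes the order a maximum adjacency order: a better vertex could be moved to position \<open>i\<close>.\<close>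
  have adj: "card (neighbours (?H f) v \<inter> (set ys \<union> set (take i ws))) \<le> b ! i"
    if p: "(f, ws) \<in> P" and i: "i < card X0" "\<And>i'. i' < i \<Longrightarrow> bd f ws ! i' = b ! i'"
      and v: "v \<in> X0 - set (take i ws)" for f i v
  proof -
    let ?ws = "take i ws @ v # filter (\<lambda>x. x \<noteq> v) (drop i ws)"
    have v': "v \<in> set (drop i ws)"
      using v ws(2) set_append[of "take i ws" "drop i ws"] by auto
    have "distinct ?ws" using ws(1) v
      distinct_append[of "take i ws" "drop i ws"] by auto
    moreover have "set ?ws = X0"
    proof -
      have "set ?ws = set (take i ws) \<union> set (drop i ws)" using v' by auto
      then show ?thesis using ws(2) set_append[of "take i ws" "drop i ws"] by simp
    qed
    ultimately have P': "(f, ?ws) \<in> P" using p unfolding P_def by blast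
    have il: "i < length ws" using i lenb by simp
    have "bd f ?ws ! i' = b ! i'" if "i' < i" for i'
    proof -
      have "bd f ?ws ! i' = bd f ws ! i'"
        using that il by (simp add: bd_nth nth_append)
      then show ?thesis using i(2) that by simp
    qed
    then have "bd f ?ws ! i \<le> b ! i" using LEX[OF P' i(1)] by blast
    then show ?thesis using il by (simp add: bd_nth nth_append)
  qed
  \<comment> \<open>Deleting the edges of a copy changes no adjacency to a vertex that is not on the copy.\<close>
  have notouch: "neighbours (?H f) w \<inter> Z = neighbours E w \<inter> Z" if "f ` {..t} \<inter> Z = {}" for f w Z
    using tree_edges_subset[OF par, of t _ f] that by (auto simp: neighbours_def)
  show ?thesis
  proof (cases "\<forall>i. 1 \<le> i \<and> i < card X0 \<longrightarrow> l \<le> b ! i")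
    case True
    let ?zs = "ys @ ws"
    have f1: "?copy f1 (U - set ys)" using P1 unfolding P_def by simp
    have f1ys: "f1 ` {..t} \<inter> set ys = {}" using f1 by blast
    have dist: "distinct ?zs" using ws okD unfolding X0_def by auto
    have setzs: "set ?zs = V" using ws okD unfolding X0_def by auto
    have ma: "max_adjacency (?H f1) V (length qs) ?zs"
      unfolding max_adjacency_def
    proof (intro allI impI ballI)
      fix p w assume p: "p < length ?zs" "length qs \<le> p" "w \<in> V - set (take p ?zs)"
      show "card (neighbours (?H f1) w \<inter> set (take p ?zs)) \<le> card (neighbours (?H f1) (?zs ! p) \<inter> set (take p ?zs))"
      proof (cases "p < length ys")
        case True
        have "f1 ` {..t} \<inter> set (take p ys) = {}" using f1ys set_take_subset[of p ys] by blast
        then show ?thesis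
          using True p okD unfolding max_adjacency_def by (simp add: notouch nth_append)
      next
        case False
        define i where "i = p - length ys"
        have i: "p = length ys + i" "i < length ws" using False p unfolding i_def by auto
        have "w \<in> X0 - set (take i ws)" using p(3) i unfolding X0_def by auto
        then have "card (neighbours (?H f1) w \<inter> (set ys \<union> set (take i ws))) \<le> b ! i"
          using adj[OF P1, of i w] i lenb unfolding b_def by simp
        then show ?thesis using i unfolding b_def by (simp add: bd_nth nth_append)
      qed
    qed
    have high: "l \<le> card (neighbours (?H f1) (?zs ! p) \<inter> set (take p ?zs))"
      if "length ys < p" "p < length ?zs" for p
    proof -
      define i where "i = p - length ys"
      have i: "p = length ys + i" "1 \<le> i" "i < length ws" using that unfolding i_def by auto
      then have "l \<le> bd f1 ws ! i" using True lenb unfolding b_def by simp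
      then show ?thesis using i by (simp add: bd_nth nth_append)
    qed
    have coreQ: "inseparable (?H f1) l u v"
      if "u \<in> set (take (length qs) ?zs)" "v \<in> set (take (length qs) ?zs)" for u v
    proof -
      have "set (take (length qs) ?zs) = Q" using okD qs(1) qlen by simp
      then show ?thesis using core[of f1 u v] f1 that by auto
    qed
    have pos: "\<exists>p. length ys \<le> p \<and> p < length ?zs \<and> ?zs ! p = f1 i" if "i \<le> t" for i
    proof -
      have "f1 i \<in> U - set ys" using f1 that by auto
      then have "f1 i \<in> set ws" using ws(2) Q(2) unfolding X0_def by auto
      then obtain a where "a < length ws" "ws ! a = f1 i" by (metis in_set_conv_nth)
      then show ?thesis by (intro exI[of _ "length ys + a"]) auto
    qed
    have "inseparable (?H f1) l (f1 i) (f1 j)" if "i \<le> t" "j \<le> t" for i j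
    proof -
      obtain p where p: "length ys \<le> p" "p < length ?zs" "?zs ! p = f1 i"
        using pos[OF \<open>i \<le> t\<close>] by blast
      obtain q where q: "length ys \<le> q" "q < length ?zs" "?zs ! q = f1 j"
        using pos[OF \<open>j \<le> t\<close>] by blast
      have "inseparable (?H f1) l (?zs ! p) (?zs ! q)"
        by (rule max_adjacency_inseparable[OF dist setzs ma coreQ high p(1,2) q(1,2)])
      then show ?thesis using p(3) q(3) by simp
    qed
    then show ?thesis using f1 by blast
  next
    case False
    then obtain j where j: "1 \<le> j" "j < card X0" "b ! j < l" by (auto simp: not_le)
    define X1 where "X1 = X0 - set (take j ws)"
    have X1c: "V - X1 = set ys \<union> set (take j ws)"
      using ws(2) okD set_take_subset[of j ws] unfolding X1_def X0_def by auto
    have "ws ! j \<in> X1"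
    proof -
      have "ws ! j \<in> X0" using nth_mem[of j ws] ws(2) j lenb by simp
      moreover have "ws ! j \<notin> set (take j ws)"
        using distinct_take[OF ws(1), of "Suc j"] j lenb by (simp add: take_Suc_conv_app_nth)
      ultimately show ?thesis unfolding X1_def by simp
    qed
    then have X1ne: "X1 \<noteq> {}" by auto
    have X1V: "X1 \<subseteq> V - Q" "X1 \<inter> set ys = {}" using Qys unfolding X1_def X0_def by auto
    \<comment> \<open>The copies that keep the entries up to the cut; one with as few vertices as possible in front of the cut has none there.\<close>
    define Fam where "Fam f \<longleftrightarrow> (f, ws) \<in> P \<and> (\<forall>i \<le> j. b ! i \<le> bd f ws ! i)" for f
    have "Fam f1" unfolding Fam_def b_def using P1 by simp
    then have "\<exists>f. Fam f \<and>
        (\<forall>g. Fam g \<longrightarrow> card {i \<in> {..t}. f i \<notin> X1} \<le> card {i \<in> {..t}. g i \<notin> X1})"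
      by (rule ex_has_least_nat[of Fam f1 "\<lambda>f. card {i \<in> {..t}. f i \<notin> X1}"])
    then obtain f where f: "Fam f"
      "\<And>g. Fam g \<Longrightarrow> card {i \<in> {..t}. f i \<notin> X1} \<le> card {i \<in> {..t}. g i \<notin> X1}" by blast
    have fP: "(f, ws) \<in> P" using f(1) unfolding Fam_def by simp
    then have fc: "tree_copy E t par f" "f ` {..t} \<subseteq> U - set ys" unfolding P_def by auto
    have fb: "bd f ws ! i = b ! i" if "i \<le> j" for i
      using PW[OF fP j(2), of i] f(1) that unfolding Fam_def by blast
    have fadj: "card (neighbours (?H f) v \<inter> (set ys \<union> set (take i ws))) \<le> b ! i"
      if "i \<le> j" "v \<in> X0 - set (take i ws)" for i v
      using adj[OF fP _ _ that(2)] that(1) j fb by simp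
    have fX1: "f ` {..t} \<subseteq> X1"
    proof (rule ccontr)
      assume out: "\<not> f ` {..t} \<subseteq> X1"
      have cl: "card (neighbours (?H f) v - X1) < l" if "v \<in> X1" for v
      proof -
        have "neighbours (?H f) v - X1 = neighbours (?H f) v \<inter> (set ys \<union> set (take j ws))"
          using X1c V(2) neighbours_mono[of "?H f" E v] by blast
        then show ?thesis using fadj[of j v] that j(3) unfolding X1_def by simp
      qed
      obtain g where g: "tree_copy E t par g" "g ` {..t} \<subseteq> U \<inter> (f ` {..t} \<union> X1)"
        "?T g \<subseteq> ?T f \<union> {e. e \<subseteq> X1}"
        "card {i \<in> {..t}. g i \<notin> X1} < card {i \<in> {..t}. f i \<notin> X1}"
        using move[OF X1ne X1V(1) fc(1) _ cl out] fc(2) by blast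
      have "g ` {..t} \<subseteq> U - set ys" using g(2) fc(2) X1V(2) by blast
      then have gP: "(g, ws) \<in> P" using g(1) fP unfolding P_def by simp
      have "b ! i \<le> bd g ws ! i" if "i \<le> j" for i
      proof -
        have il: "i < length ws" using that j lenb by simp
        have "set ys \<union> set (take i ws) \<subseteq> V - X1"
          unfolding X1c using set_take_subset_set_take[OF that, of ws] by blast
        then have "neighbours (?H f) (ws ! i) \<inter> (set ys \<union> set (take i ws)) \<subseteq>
            neighbours (?H g) (ws ! i) \<inter> (set ys \<union> set (take i ws))"
          using g(3) unfolding neighbours_def by auto
        moreover have "finite (neighbours (?H g) (ws ! i) \<inter> (set ys \<union> set (take i ws)))" by simp
        ultimately have "bd f ws ! i \<le> bd g ws ! i" using il by (simp add: bd_nth card_mono)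
        then show ?thesis using fb[OF that] by simp
      qed
      then have "Fam g" unfolding Fam_def using gP by simp
      then show False using f(2)[of g] g(4) by simp
    qed
    let ?ys = "ys @ take j ws"
    have "ok ?ys"
      unfolding ok_def
    proof (intro conjI)
      show "distinct ?ys" using okD ws unfolding X0_def by (auto dest: in_set_takeD)
      show "set ?ys \<subseteq> V" using X1c by auto
      show "take (length qs) ?ys = qs" using okD qlen by simp
      show "\<exists>f. ?copy f (U - set ?ys)"
        using fc fX1 X1c by (intro exI[of _ f]) auto
      show "max_adjacency E V (length qs) ?ys"
        unfolding max_adjacency_def
      proof (intro allI impI ballI)
        fix p w assume p: "p < length ?ys" "length qs \<le> p" "w \<in> V - set (take p ?ys)"
        show "card (neighbours E w \<inter> set (take p ?ys)) \<le> card (neighbours E (?ys ! p) \<inter> set (take p ?ys))"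
        proof (cases "p < length ys")
          case True
          then show ?thesis
            using p okD unfolding max_adjacency_def by (simp add: nth_append)
        next
          case False
          define i where "i = p - length ys"
          have i: "p = length ys + i" "i < j" "i < length ws"
            using False p j lenb unfolding i_def by auto
          have tk: "take p ?ys = ys @ take i ws" using i by (simp add: min_absorb1)
          have nt: "f ` {..t} \<inter> set (take p ?ys) = {}"
            using fX1 X1c set_take_subset[of p ?ys] by auto
          have "card (neighbours (?H f) w \<inter> set (take p ?ys)) \<le> b ! i"
            using fadj[of i w] p(3) i unfolding tk X0_def by auto
          also have "b ! i = card (neighbours (?H f) (?ys ! p) \<inter> set (take p ?ys))"
            using fb[of i] i unfolding tk by (simp add: bd_nth nth_append)
          finally show ?thesis unfolding notouch[OF nt] .
        qed
      qed
    qed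
    then have "length ?ys \<le> length ys" by (rule ys(2))
    then show ?thesis using j lenb by simp
  qed
qed

section \<open>Placing the components one after the other\<close>

text \<open>
  In the following, \<open>FE\<close> is the edge set of the forest. The separated sets of vertices are the unions of
  components.
\<close>

definition separated :: "'b set set \<Rightarrow> 'b set \<Rightarrow> bool" where
  "separated FE P \<longleftrightarrow> (\<forall>e \<in> FE. e \<subseteq> P \<or> e \<inter> P = {})"

definition tree_order :: "'b set set \<Rightarrow> 'b set \<Rightarrow> nat \<Rightarrow> (nat \<Rightarrow> nat) \<Rightarrow> (nat \<Rightarrow> 'b) \<Rightarrow> bool" where
  "tree_order FE C t par h \<longleftrightarrow> bij_betw h {..t} C \<and> (\<forall>i. 1 \<le> i \<longrightarrow> i \<le> t \<longrightarrow> par i < i) \<and>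
     {e \<in> FE. e \<subseteq> C} = tree_edges t par h"

definition image_edges :: "'b set set \<Rightarrow> 'b set \<Rightarrow> ('b \<Rightarrow> 'a) \<Rightarrow> 'a set set" where
  "image_edges FE P \<phi> = (`) \<phi> ` {e \<in> FE. e \<subseteq> P}"

lemma separated_Un: "separated FE P \<Longrightarrow> separated FE P' \<Longrightarrow> separated FE (P \<union> P')"
  unfolding separated_def by blast

lemma tree_edges_card: "finite (tree_edges t par f) \<and> card (tree_edges t par f) \<le> t"
  unfolding tree_edges_def using card_image_le[of "{1..t}" "\<lambda>i. {f i, f (par i)}"] by simp

lemma inseparable_minus_tree:
  assumes "inseparable E (l + t) u v" shows "inseparable (E - tree_edges t par f) l u v"
  by (rule inseparable_delete) (use assms tree_edges_card[of t par f] in \<open>auto intro: inseparable_weaken\<close>)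

locale dense_graph =
  fixes V :: "'a set" and E :: "'a set set" and d :: nat
  assumes finV: "finite V" and neV: "V \<noteq> {}"
    and neighbours_V: "\<And>v. neighbours E v \<subseteq> V" and loopfree: "\<And>v. v \<notin> neighbours E v"
    and deg: "\<And>v. v \<in> V \<Longrightarrow> d \<le> card (neighbours E v)"
begin

text \<open>
  The state of the construction: \<open>P1\<close> is the first component, \<open>P2\<close> the union of the other components
  placed so far, and \<open>\<phi>\<close> embeds both. What remains of the graph cannot separate two vertices of
  the first component, nor the ends of a used edge, by fewer than \<open>l\<close> vertices and edges.
\<close>

definition placed :: "'b set set \<Rightarrow> ('b \<Rightarrow> 'a) \<Rightarrow> 'b set \<Rightarrow> 'b set \<Rightarrow> nat \<Rightarrow> bool" where
  "placed FE \<phi> P1 P2 l \<longleftrightarrow> finite (P1 \<union> P2) \<and> P1 \<inter> P2 = {} \<and> separated FE P1 \<and> separated FE P2 \<and>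
     inj_on \<phi> (P1 \<union> P2) \<and> \<phi> ` (P1 \<union> P2) \<subseteq> V \<and> image_edges FE (P1 \<union> P2) \<phi> \<subseteq> E \<and>
     (\<forall>u \<in> P1. \<forall>v \<in> P1. inseparable (E - image_edges FE (P1 \<union> P2) \<phi>) l (\<phi> u) (\<phi> v)) \<and>
     (\<forall>u v. {u, v} \<in> FE \<longrightarrow> {u, v} \<subseteq> P1 \<union> P2 \<longrightarrow>
        inseparable (E - image_edges FE (P1 \<union> P2) \<phi>) l (\<phi> u) (\<phi> v))"

lemma card_V: "d < card V"
proof -
  obtain v where v: "v \<in> V" using neV by auto
  have "neighbours E v \<subset> V" using neighbours_V[of v] loopfree[of v] v by auto
  then have "card (neighbours E v) < card V" using finV by (rule psubset_card_mono[rotated])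
  then show ?thesis using deg[OF v] by simp
qed

lemma neighbours_avoid:
  assumes "v \<notin> \<phi> ` P" shows "neighbours (E - image_edges FE P \<phi>) v = neighbours E v"
  using assms unfolding neighbours_def image_edges_def by blast

lemma extend_copy:
  fixes \<phi> :: "'b \<Rightarrow> 'a"
  assumes g: "placed FE \<phi> P1 P2 (l + t)"
    and C: "tree_order FE C t par h" "separated FE C" "C \<inter> (P1 \<union> P2) = {}"
    and FE: "\<And>e. e \<in> FE \<Longrightarrow> e \<noteq> {}"
    and f: "tree_copy (E - image_edges FE (P1 \<union> P2) \<phi>) t par f" "f ` {..t} \<subseteq> V - \<phi> ` (P1 \<union> P2)"
    and pair: "\<And>i j. i \<le> t \<Longrightarrow> j \<le> t \<Longrightarrow>
      inseparable (E - image_edges FE (P1 \<union> P2) \<phi> - tree_edges t par f) l (f i) (f j)"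
  shows "\<exists>\<phi>'. placed FE \<phi>' P1 (P2 \<union> C) l \<and>
    (\<forall>u \<in> C. \<forall>v \<in> C. inseparable (E - image_edges FE (P1 \<union> P2 \<union> C) \<phi>') l (\<phi>' u) (\<phi>' v))"
proof -
  let ?P = "P1 \<union> P2"
  have gfin: "finite ?P" and gdisj: "P1 \<inter> P2 = {}" and gsep: "separated FE P1" "separated FE P2"
    and ginj: "inj_on \<phi> ?P" and gV: "\<phi> ` ?P \<subseteq> V" and gE: "image_edges FE ?P \<phi> \<subseteq> E"
    and gcore: "\<And>u v. u \<in> P1 \<Longrightarrow> v \<in> P1 \<Longrightarrow> inseparable (E - image_edges FE ?P \<phi>) (l + t) (\<phi> u) (\<phi> v)"
    and gpair: "\<And>u v. {u, v} \<in> FE \<Longrightarrow> {u, v} \<subseteq> ?P \<Longrightarrow> inseparable (E - image_edges FE ?P \<phi>) (l + t) (\<phi> u) (\<phi> v)"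
    using g unfolding placed_def by simp_all
  have h: "bij_betw h {..t} C" "{e \<in> FE. e \<subseteq> C} = tree_edges t par h"
    and par: "\<And>i. 1 \<le> i \<Longrightarrow> i \<le> t \<Longrightarrow> par i < i"
    using C(1) unfolding tree_order_def by auto
  define \<phi>' where "\<phi>' x = (if x \<in> C then f (inv_into {..t} h x) else \<phi> x)" for x
  have \<phi>'h: "\<phi>' (h i) = f i" if "i \<le> t" for i
    using h(1) that unfolding \<phi>'_def bij_betw_def by auto
  have Cim: "C = h ` {..t}" using h(1) unfolding bij_betw_def by simp
  have \<phi>'P: "\<phi>' x = \<phi> x" if "x \<in> ?P" for x using that C(3) unfolding \<phi>'_def by auto
  have \<phi>'C: "\<phi>' ` C = f ` {..t}"
  proof -
    have "\<phi>' ` C = (\<lambda>i. \<phi>' (h i)) ` {..t}" unfolding Cim by auto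
    also have "\<dots> = f ` {..t}" using \<phi>'h by (intro image_cong) auto
    finally show ?thesis .
  qed
  have \<phi>'Pim: "\<phi>' ` ?P = \<phi> ` ?P" using \<phi>'P by (intro image_cong) auto
  have imgs: "image_edges FE (?P \<union> C) \<phi>' = image_edges FE ?P \<phi> \<union> tree_edges t par f"
  proof -
    have "{e \<in> FE. e \<subseteq> ?P \<union> C} = {e \<in> FE. e \<subseteq> ?P} \<union> {e \<in> FE. e \<subseteq> C}"
      using C(2,3) unfolding separated_def by blast
    then have "image_edges FE (?P \<union> C) \<phi>' = image_edges FE ?P \<phi>' \<union> (`) \<phi>' ` tree_edges t par h"
      unfolding image_edges_def h(2)[symmetric] by auto
    moreover have "image_edges FE ?P \<phi>' = image_edges FE ?P \<phi>"
      unfolding image_edges_def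
    proof (rule image_cong)
      fix e assume "e \<in> {e \<in> FE. e \<subseteq> ?P}"
      then show "\<phi>' ` e = \<phi> ` e" using \<phi>'P by (intro image_cong) auto
    qed simp
    moreover have "(`) \<phi>' ` tree_edges t par h = tree_edges t par f"
      unfolding tree_edges_def image_image
    proof (rule image_cong)
      fix i assume i: "i \<in> {1..t}"
      then have "par i \<le> t" using par[of i] by auto
      then show "\<phi>' ` {h i, h (par i)} = {f i, f (par i)}" using i \<phi>'h by simp
    qed simp
    ultimately show ?thesis by simp
  qed
  have diff: "E - image_edges FE (?P \<union> C) \<phi>' = E - image_edges FE ?P \<phi> - tree_edges t par f"
    unfolding imgs by blast
  have finj: "inj_on f {..t}" using f(1) unfolding tree_copy_def by simp
  have injC: "inj_on \<phi>' C"
  proof (rule inj_onI)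
    fix x y assume "x \<in> C" "y \<in> C" "\<phi>' x = \<phi>' y"
    then obtain i j where "x = h i" "y = h j" "i \<le> t" "j \<le> t" unfolding Cim by auto
    then show "x = y" using \<open>\<phi>' x = \<phi>' y\<close> \<phi>'h inj_onD[OF finj, of i j] by simp
  qed
  have injP: "inj_on \<phi>' ?P" using ginj \<phi>'P inj_on_cong[of ?P \<phi>' \<phi>] by blast
  have "inj_on \<phi>' (?P \<union> C)"
    using injP injC \<phi>'C \<phi>'Pim f(2) inj_on_Un[of \<phi>' ?P C] by blast
  have old: "inseparable (E - image_edges FE (?P \<union> C) \<phi>') l (\<phi>' u) (\<phi>' v)"
    if "inseparable (E - image_edges FE ?P \<phi>) (l + t) (\<phi> u) (\<phi> v)" "u \<in> ?P" "v \<in> ?P" for u v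
    using inseparable_minus_tree[OF that(1)] that(2,3) \<phi>'P unfolding diff by simp
  have new: "inseparable (E - image_edges FE (?P \<union> C) \<phi>') l (\<phi>' u) (\<phi>' v)" if uv: "u \<in> C" "v \<in> C" for u v
  proof -
    obtain i j where "u = h i" "v = h j" "i \<le> t" "j \<le> t" using uv unfolding Cim by auto
    then show ?thesis using pair[of i j] \<phi>'h unfolding diff by simp
  qed
  have eq: "P1 \<union> (P2 \<union> C) = ?P \<union> C" by auto
  have "placed FE \<phi>' P1 (P2 \<union> C) l"
    unfolding placed_def eq
  proof (intro conjI ballI allI impI)
    show "finite (?P \<union> C)" using gfin unfolding Cim by simp
    show "P1 \<inter> (P2 \<union> C) = {}" using gdisj C(3) by blast
    show "separated FE P1" by (rule gsep)
    show "separated FE (P2 \<union> C)" using gsep(2) C(2) by (rule separated_Un)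
    show "inj_on \<phi>' (?P \<union> C)" by fact
    show "\<phi>' ` (?P \<union> C) \<subseteq> V"
    proof -
      have "\<phi>' ` (?P \<union> C) = \<phi>' ` ?P \<union> \<phi>' ` C" by (rule image_Un)
      then show ?thesis unfolding \<phi>'C \<phi>'Pim using f(2) gV by blast
    qed
    show "image_edges FE (?P \<union> C) \<phi>' \<subseteq> E"
    proof -
      have "tree_edges t par f \<subseteq> E" using f(1) unfolding tree_copy_def tree_edges_def by auto
      then show ?thesis using gE unfolding imgs by blast
    qed
    show "inseparable (E - image_edges FE (?P \<union> C) \<phi>') l (\<phi>' u) (\<phi>' v)" if "u \<in> P1" "v \<in> P1" for u v
      using that by (intro old gcore) auto
    show "inseparable (E - image_edges FE (?P \<union> C) \<phi>') l (\<phi>' u) (\<phi>' v)"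
      if uv: "{u, v} \<in> FE" "{u, v} \<subseteq> ?P \<union> C" for u v
    proof (cases "{u, v} \<subseteq> ?P")
      case True
      then show ?thesis using old[OF gpair[OF uv(1) True]] by simp
    next
      case False
      moreover have "{u, v} \<subseteq> C \<or> {u, v} \<inter> C = {}"
        using bspec[OF C(2)[unfolded separated_def] uv(1)] .
      ultimately have "u \<in> C" "v \<in> C" using uv(2) by auto
      then show ?thesis by (rule new)
    qed
  qed
  then show ?thesis using new by blast
qed

text \<open>
  If \<open>v\<close> is on the copy of a component in \<open>P2\<close>, then the edges deleted at \<open>v\<close> lead to forbidden
  vertices only, so their loss is already accounted for; and \<open>v\<close> is a forbidden vertex itself but no
  neighbour of \<open>v\<close>, which gains one.
\<close>

lemma stage_degree:
  fixes \<phi> :: "'b \<Rightarrow> 'a"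
  assumes g: "placed FE \<phi> P1 P2 L" and v: "v \<in> V" "v \<notin> \<phi> ` P1"
  shows "d \<le> card (neighbours (E - image_edges FE (P1 \<union> P2) \<phi>) v - \<phi> ` P2) + card (\<phi> ` P2 - {v})"
proof -
  let ?G = "E - image_edges FE (P1 \<union> P2) \<phi>" and ?Q = "\<phi> ` P2"
  note gD = g[unfolded placed_def]
  have "neighbours E v - ?Q \<subseteq> neighbours ?G v"
  proof
    fix w assume w: "w \<in> neighbours E v - ?Q"
    have "{v, w} \<notin> image_edges FE (P1 \<union> P2) \<phi>"
    proof
      assume "{v, w} \<in> image_edges FE (P1 \<union> P2) \<phi>"
      then obtain e where e: "e \<in> FE" "e \<subseteq> P1 \<union> P2" "\<phi> ` e = {v, w}"
        unfolding image_edges_def by auto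
      have "e \<subseteq> P1 \<or> e \<inter> P1 = {}" using gD e(1) unfolding separated_def by blast
      moreover have "\<not> e \<subseteq> P1" using e(3) v(2) by blast
      ultimately have "e \<subseteq> P2" using e(2) by blast
      then have "w \<in> ?Q" using e(3) by blast
      then show False using w by simp
    qed
    then show "w \<in> neighbours ?G v" using w unfolding neighbours_def by simp
  qed
  then have "neighbours E v \<subseteq> (neighbours ?G v - ?Q) \<union> (?Q - {v})" using loopfree[of v] by auto
  moreover have "finite (neighbours ?G v)" using neighbours_V[of v] finV neighbours_mono[of ?G E v] by (meson Diff_subset finite_subset)
  moreover have "finite ?Q" using gD by simp
  ultimately have "card (neighbours E v) \<le> card ((neighbours ?G v - ?Q) \<union> (?Q - {v}))" by (intro card_mono) auto
  also have "\<dots> \<le> card (neighbours ?G v - ?Q) + card (?Q - {v})" by (rule card_Un_le)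
  finally show ?thesis using deg[OF v(1)] by simp
qed

lemma stage_exists:
  fixes \<phi> :: "'b \<Rightarrow> 'a"
  assumes g: "placed FE \<phi> P1 P2 L" and par: "\<And>i. 1 \<le> i \<Longrightarrow> i \<le> t \<Longrightarrow> par i < i"
    and room: "t + card (P1 \<union> P2) \<le> d"
  shows "\<exists>f. tree_copy (E - image_edges FE (P1 \<union> P2) \<phi>) t par f \<and> f ` {..t} \<subseteq> V - \<phi> ` (P1 \<union> P2)"
proof (rule greedy_embed[OF par])
  let ?G = "E - image_edges FE (P1 \<union> P2) \<phi>" and ?W = "V - \<phi> ` (P1 \<union> P2)"
  note gD = g[unfolded placed_def]
  have fin: "finite (\<phi> ` (P1 \<union> P2))" using gD by blast
  have cP: "card (\<phi> ` (P1 \<union> P2)) \<le> card (P1 \<union> P2)" using gD card_image_le by blast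
  show "finite ?W" using finV by simp
  show "?W \<noteq> {}"
  proof
    assume "?W = {}"
    then have "card V \<le> card (\<phi> ` (P1 \<union> P2))" using fin by (intro card_mono) auto
    then show False using cP card_V room by simp
  qed
  show "v \<notin> neighbours ?G v" for v using loopfree[of v] unfolding neighbours_def by auto
  show "t \<le> card (neighbours ?G v \<inter> ?W)" if v: "v \<in> ?W" for v
  proof -
    have "neighbours ?G v = neighbours E v" using v by (intro neighbours_avoid) simp
    moreover have "neighbours E v \<subseteq> (neighbours E v \<inter> ?W) \<union> \<phi> ` (P1 \<union> P2)" using neighbours_V[of v] by auto
    then have "card (neighbours E v) \<le> card ((neighbours E v \<inter> ?W) \<union> \<phi> ` (P1 \<union> P2))"
      using fin finV by (intro card_mono) auto
    moreover have "card ((neighbours E v \<inter> ?W) \<union> \<phi> ` (P1 \<union> P2)) \<le> card (neighbours E v \<inter> ?W) + card (\<phi> ` (P1 \<union> P2))"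
      by (rule card_Un_le)
    ultimately show ?thesis using deg[of v] v cP room by simp
  qed
qed simp

lemma stage_core:
  fixes \<phi> :: "'b \<Rightarrow> 'a"
  assumes g: "placed FE \<phi> P1 P2 (l + t)" and uv: "u \<in> \<phi> ` P1" "v \<in> \<phi> ` P1"
  shows "inseparable (E - image_edges FE (P1 \<union> P2) \<phi> - tree_edges t par f) l u v"
  using g uv unfolding placed_def by (intro inseparable_minus_tree) auto

lemma extend_tree:
  fixes \<phi> :: "'b \<Rightarrow> 'a"
  assumes g: "placed FE \<phi> P1 P2 (l + t)"
    and C: "tree_order FE C t par h" "separated FE C" "C \<inter> (P1 \<union> P2) = {}"
    and FE: "\<And>e. e \<in> FE \<Longrightarrow> e \<noteq> {}"
    and deg2: "l + t + card P2 \<le> d" and room: "t + card (P1 \<union> P2) \<le> d"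
  shows "\<exists>\<phi>'. placed FE \<phi>' P1 (P2 \<union> C) l \<and>
    (\<forall>u \<in> C. \<forall>v \<in> C. inseparable (E - image_edges FE (P1 \<union> P2 \<union> C) \<phi>') l (\<phi>' u) (\<phi>' v))"
proof -
  let ?G = "E - image_edges FE (P1 \<union> P2) \<phi>" and ?U = "V - \<phi> ` (P1 \<union> P2)"
  note gD = g[unfolded placed_def]
  have par: "\<And>i. 1 \<le> i \<Longrightarrow> i \<le> t \<Longrightarrow> par i < i" using C(1) unfolding tree_order_def by auto
  have nbG: "neighbours ?G v \<subseteq> V" "v \<notin> neighbours ?G v" for v
    using neighbours_V[of v] loopfree[of v] neighbours_mono[of ?G E v] by blast+
  have "\<exists>f. tree_copy ?G t par f \<and> f ` {..t} \<subseteq> ?U \<and>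
    (\<forall>i \<le> t. \<forall>j \<le> t. inseparable (?G - tree_edges t par f) l (f i) (f j))"
  proof (rule tree_stage[OF par finV nbG(1), where Q = "\<phi> ` P1"])
    show "\<phi> ` P1 \<subseteq> V" "?U \<subseteq> V - \<phi> ` P1" using gD by auto
    show "\<exists>f. tree_copy ?G t par f \<and> f ` {..t} \<subseteq> ?U" by (rule stage_exists[OF g par room])
    show "inseparable (?G - tree_edges t par f) l u v" if "u \<in> \<phi> ` P1" "v \<in> \<phi> ` P1" for f u v
      by (rule stage_core[OF g that])
    fix X f
    assume X: "X \<noteq> {}" "X \<subseteq> V - \<phi> ` P1" and f: "tree_copy ?G t par f" "f ` {..t} \<subseteq> ?U"
      and cl: "\<And>v. v \<in> X \<Longrightarrow> card (neighbours (?G - tree_edges t par f) v - X) < l" and out: "\<not> f ` {..t} \<subseteq> X"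
    have dX: "l + t \<le> card (neighbours ?G v - \<phi> ` P2)" if "v \<in> X" for v
    proof -
      have "d \<le> card (neighbours ?G v - \<phi> ` P2) + card (\<phi> ` P2 - {v})"
        using X that by (intro stage_degree[OF g]) auto
      moreover have "card (\<phi> ` P2 - {v}) \<le> card P2"
        using gD card_image_le[of P2 \<phi>] card_Diff1_le[of "\<phi> ` P2" v] by simp
      ultimately show ?thesis using deg2 by simp
    qed
    have fQ: "f ` {..t} \<inter> \<phi> ` P2 = {}" using f(2) by blast
    have XV: "X \<subseteq> V" using X by blast
    obtain g' where g': "tree_copy ?G t par g'" "g' ` {..t} \<subseteq> f ` {..t} \<union> (X - \<phi> ` P2)"
      "tree_edges t par g' \<subseteq> tree_edges t par f \<union> {e. e \<subseteq> X}"
      "card {i \<in> {..t}. g' i \<notin> X} < card {i \<in> {..t}. f i \<notin> X}"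
      using move_tree[OF par finV nbG f(1) fQ X(1) XV dX cl out] by blast
    have "g' ` {..t} \<subseteq> ?U \<inter> (f ` {..t} \<union> X)" using g'(2) f(2) X(2) by blast
    then show "\<exists>g. tree_copy ?G t par g \<and> g ` {..t} \<subseteq> ?U \<inter> (f ` {..t} \<union> X) \<and>
        tree_edges t par g \<subseteq> tree_edges t par f \<union> {e. e \<subseteq> X} \<and>
        card {i \<in> {..t}. g i \<notin> X} < card {i \<in> {..t}. f i \<notin> X}" using g' by blast
  qed
  then obtain f where f: "tree_copy ?G t par f" "f ` {..t} \<subseteq> ?U"
    "\<forall>i \<le> t. \<forall>j \<le> t. inseparable (?G - tree_edges t par f) l (f i) (f j)" by (elim exE conjE)
  then have pair: "inseparable (?G - tree_edges t par f) l (f i) (f j)" if "i \<le> t" "j \<le> t" for i j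
    using that by simp
  show ?thesis by (rule extend_copy[OF g C FE f(1,2) pair])
qed

text \<open>
  A tree with a single edge can be placed with a degree smaller by one than \<open>extend_tree\<close> asks for. A
  vertex of \<open>X\<close> in \<open>P2\<close> still has two neighbours in \<open>X\<close> outside \<open>P2\<close>, and a vertex of \<open>X\<close> that is
  on neither the copy nor \<open>P2\<close> has one; in the latter case an edge of \<open>X\<close> is found at once.
  If there is no such vertex, then, as the old edge does not lie in \<open>X\<close>, at most one vertex of \<open>X\<close> is
  outside \<open>P2\<close>. So \<open>X\<close> does not meet \<open>P2\<close>, and consists of one vertex, although that vertex has a
  neighbour in \<open>X\<close>.
\<close>

lemma extend_edge:
  fixes \<phi> :: "'b \<Rightarrow> 'a"
  assumes g: "placed FE \<phi> P1 P2 (l + 1)"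
    and C: "tree_order FE C 1 par h" "separated FE C" "C \<inter> (P1 \<union> P2) = {}"
    and FE: "\<And>e. e \<in> FE \<Longrightarrow> e \<noteq> {}"
    and deg2: "l + card P2 \<le> d" "P2 \<noteq> {}" and room: "1 + card (P1 \<union> P2) \<le> d"
  shows "\<exists>\<phi>'. placed FE \<phi>' P1 (P2 \<union> C) l"
proof -
  let ?G = "E - image_edges FE (P1 \<union> P2) \<phi>" and ?U = "V - \<phi> ` (P1 \<union> P2)" and ?Q = "\<phi> ` P2"
  note gD = g[unfolded placed_def]
  have finP2: "finite P2" using gD by simp
  have cQ: "card ?Q \<le> card P2" using card_image_le[OF finP2] .
  have cP2: "0 < card P2" using finP2 deg2(2) by (simp add: card_gt_0_iff)
  have par: "\<And>i. 1 \<le> i \<Longrightarrow> i \<le> 1 \<Longrightarrow> par i < i" using C(1) unfolding tree_order_def by auto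
  have par1: "par (Suc 0) = 0" using par[of 1] by simp
  have nbG: "neighbours ?G v \<subseteq> V" "v \<notin> neighbours ?G v" for v
    using neighbours_V[of v] loopfree[of v] neighbours_mono[of ?G E v] by blast+
  have finG: "finite (neighbours ?G v)" for v using nbG(1) finV by (rule finite_subset)
  have "\<exists>f. tree_copy ?G 1 par f \<and> f ` {..1} \<subseteq> ?U \<and>
    (\<forall>i \<le> 1. \<forall>j \<le> 1. inseparable (?G - tree_edges 1 par f) l (f i) (f j))"
  proof (rule tree_stage[OF par finV nbG(1), where Q = "\<phi> ` P1"])
    show "\<phi> ` P1 \<subseteq> V" "?U \<subseteq> V - \<phi> ` P1" using gD by auto
    show "\<exists>f. tree_copy ?G 1 par f \<and> f ` {..1} \<subseteq> ?U" by (rule stage_exists[OF g par room])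
    show "inseparable (?G - tree_edges 1 par f) l u v" if "u \<in> \<phi> ` P1" "v \<in> \<phi> ` P1" for f u v
      by (rule stage_core[OF g that])
    fix X f
    assume X: "X \<noteq> {}" "X \<subseteq> V - \<phi> ` P1" and f: "tree_copy ?G 1 par f" "f ` {..1} \<subseteq> ?U"
      and cl: "\<And>v. v \<in> X \<Longrightarrow> card (neighbours (?G - tree_edges 1 par f) v - X) < l" and out: "\<not> f ` {..1} \<subseteq> X"
    let ?T = "tree_edges 1 par f"
    have atm: "{..1::nat} = {0, 1}" by auto
    have T: "?T = {{f 1, f 0}}" unfolding tree_edges_def using par1 by simp
    have f01: "f 0 \<noteq> f 1" using f(1) unfolding tree_copy_def atm by simp
    have nbT0: "neighbours ?T v = {}" if "v \<notin> f ` {..1}" for v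
      using that unfolding T neighbours_def atm by (auto simp: doubleton_eq_iff)
    have nbT1: "card (neighbours ?T v) \<le> 1" for v
    proof -
      have "neighbours ?T v \<subseteq> {if v = f 0 then f 1 else f 0}"
        unfolding T neighbours_def using f01 by (auto simp: doubleton_eq_iff)
      then show ?thesis using card_mono[of "{if v = f 0 then f 1 else f 0}" "neighbours ?T v"] by simp
    qed
    have finT: "finite (neighbours ?T v)" for v
      unfolding T neighbours_def by (rule finite_subset[of _ "{f 0, f 1}"]) (auto simp: doubleton_eq_iff)
    have split: "card (neighbours ?G v - Z) \<le> card (neighbours ?G v \<inter> (X - Z)) + card (neighbours (?G - ?T) v - X) + card (neighbours ?T v)"
      for v Z
    proof -
      have "neighbours ?G v - Z \<subseteq> (neighbours ?G v \<inter> (X - Z)) \<union> (neighbours (?G - ?T) v - X) \<union> neighbours ?T v"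
        by (auto simp: neighbours_def)
      moreover have "finite (neighbours (?G - ?T) v)"
        using finG[of v] neighbours_mono[of "?G - ?T" ?G v] finite_subset by blast
      ultimately have "card (neighbours ?G v - Z) \<le> card ((neighbours ?G v \<inter> (X - Z)) \<union> (neighbours (?G - ?T) v - X) \<union> neighbours ?T v)"
        using finG[of v] finT[of v] by (intro card_mono) auto
      also have "\<dots> \<le> card (neighbours ?G v \<inter> (X - Z)) + card (neighbours (?G - ?T) v - X) + card (neighbours ?T v)"
        using card_Un_le[of "(neighbours ?G v \<inter> (X - Z)) \<union> (neighbours (?G - ?T) v - X)" "neighbours ?T v"]
          card_Un_le[of "neighbours ?G v \<inter> (X - Z)" "neighbours (?G - ?T) v - X"] by linarith
      finally show ?thesis .
    qed
    have stage: "d \<le> card (neighbours ?G v - ?Q) + card (?Q - {v})" if "v \<in> X" for v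
      using X that by (intro stage_degree[OF g]) auto
    have occupied: "2 \<le> card (neighbours ?G v \<inter> (X - ?Q))" if v: "v \<in> X" "v \<in> ?Q" for v
    proof -
      have "card (?Q - {v}) < card ?Q" using v finP2 by (intro psubset_card_mono) auto
      moreover have "neighbours ?T v = {}" using f(2) v by (intro nbT0) blast
      ultimately show ?thesis
        using split[of v ?Q] stage[OF v(1)] cl[OF v(1)] cQ deg2(1) by simp
    qed
    have free: "1 \<le> card (neighbours ?G v \<inter> (X - ?Q))" if v: "v \<in> X" "v \<notin> ?Q" "v \<notin> f ` {..1}" for v
    proof -
      have "card (?Q - {v}) \<le> card P2" using v cQ by simp
      then show ?thesis
        using split[of v ?Q] stage[OF v(1)] cl[OF v(1)] nbT0[OF v(3)] deg2(1) by simp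
    qed
    have ends: "1 \<le> card (neighbours ?G v \<inter> X)" if v: "v \<in> X" "v \<notin> ?Q" for v
    proof -
      have "v \<in> V" "v \<notin> \<phi> ` (P1 \<union> P2)" using X v by auto
      then have "d \<le> card (neighbours ?G v)" using deg[of v] neighbours_avoid[of v \<phi> "P1 \<union> P2" FE] by simp
      then show ?thesis
        using split[of v "{}"] cl[OF v(1)] nbT1[of v] deg2(1) cP2 by simp
    qed
    obtain x y where xy: "x \<in> X - ?Q" "y \<in> X - ?Q" "{y, x} \<in> ?G"
    proof (cases "\<exists>v \<in> X - ?Q. v \<notin> f ` {..1}")
      case True
      then obtain v where v: "v \<in> X - ?Q" "v \<notin> f ` {..1}" by blast
      then have "neighbours ?G v \<inter> (X - ?Q) \<noteq> {}" using free[of v] by auto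
      then show ?thesis using that v(1) unfolding neighbours_def by blast
    next
      case False
      then have sub: "X - ?Q \<subseteq> {f 0, f 1}" unfolding atm by auto
      have "\<not> {f 0, f 1} \<subseteq> X" using out unfolding atm by simp
      then have small: "card (X - ?Q) \<le> 1"
      proof -
        have "X - ?Q \<subset> {f 0, f 1}" using sub \<open>\<not> {f 0, f 1} \<subseteq> X\<close> by blast
        then have "card (X - ?Q) < card {f 0, f 1}" by (intro psubset_card_mono) auto
        then show ?thesis using f01 by simp
      qed
      have finXQ: "finite (X - ?Q)" using sub finite_subset by blast
      have "X \<inter> ?Q = {}"
      proof (rule ccontr)
        assume "X \<inter> ?Q \<noteq> {}"
        then obtain v where v: "v \<in> X" "v \<in> ?Q" by blast
        have "card (neighbours ?G v \<inter> (X - ?Q)) \<le> card (X - ?Q)" using finXQ by (intro card_mono) auto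
        then show False using occupied[OF v] small by simp
      qed
      then have XX: "X - ?Q = X" by blast
      obtain v where v: "v \<in> X" using X(1) by blast
      then have "v \<notin> ?Q" using XX by blast
      then have "neighbours ?G v \<inter> X \<noteq> {}" using ends[OF v] by auto
      then show ?thesis using that[of v] v XX unfolding neighbours_def by (auto simp: insert_commute)
    qed
    have "x \<noteq> y" using xy(3) nbG(2)[of x] unfolding neighbours_def by auto
    define g' where "g' i = (if i = 0 then x else y)" for i :: nat
    have gim: "g' ` {..1} = {x, y}" unfolding atm g'_def by auto
    have "tree_copy ?G 1 par g'"
      using \<open>x \<noteq> y\<close> xy(3) par1 unfolding tree_copy_def g'_def atm by simp
    moreover have "g' ` {..1} \<subseteq> ?U \<inter> (f ` {..1} \<union> X)"
      unfolding gim using xy X(2) by auto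
    moreover have "tree_edges 1 par g' \<subseteq> ?T \<union> {e. e \<subseteq> X}"
      using tree_edges_subset[OF par, of 1 _ g'] xy unfolding gim by blast
    moreover have "card {i \<in> {..1}. g' i \<notin> X} < card {i \<in> {..1}. f i \<notin> X}"
    proof -
      have "{i \<in> {..1::nat}. g' i \<notin> X} = {}" using gim xy by auto
      moreover have "{i \<in> {..1::nat}. f i \<notin> X} \<noteq> {}" using out by auto
      ultimately show ?thesis by (simp only: card.empty) (simp add: card_gt_0_iff)
    qed
    ultimately show "\<exists>g. tree_copy ?G 1 par g \<and> g ` {..1} \<subseteq> ?U \<inter> (f ` {..1} \<union> X) \<and>
        tree_edges 1 par g \<subseteq> ?T \<union> {e. e \<subseteq> X} \<and>
        card {i \<in> {..1}. g i \<notin> X} < card {i \<in> {..1}. f i \<notin> X}" by blast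
  qed
  then obtain f where f: "tree_copy ?G 1 par f" "f ` {..1} \<subseteq> ?U"
    "\<forall>i \<le> 1. \<forall>j \<le> 1. inseparable (?G - tree_edges 1 par f) l (f i) (f j)" by (elim exE conjE)
  then have pair: "inseparable (?G - tree_edges 1 par f) l (f i) (f j)" if "i \<le> 1" "j \<le> 1" for i j
    using that by simp
  show ?thesis using extend_copy[OF g C FE f(1,2) pair] by blast
qed

lemma placed_merge:
  assumes "placed FE \<phi> P1 P2 l" shows "placed FE \<phi> {} (P1 \<union> P2) l"
  using assms separated_Un[of FE P1 P2] unfolding placed_def separated_def by simp

lemma tree_order_card:
  assumes "tree_order FE C t par h" shows "card C = t + 1" "finite C"
proof -
  have "bij_betw h {..t} C" using assms unfolding tree_order_def by simp
  then show "card C = t + 1" "finite C"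
    using bij_betw_same_card[of h "{..t}" C] bij_betw_finite[of h "{..t}" C] by auto
qed

text \<open>
  The number \<open>c\<close> counts the components in \<open>P2\<close>, so that \<open>card P2 - c\<close> is the number of their edges. The
  equation says that \<open>d\<close> is \<open>k\<close> plus the number of all forest edges. At each step the forbidden
  set \<open>P2\<close> costs \<open>c\<close> more than the edges of its components, which the \<open>card P1 - 1\<close> edges of
  the first component cover.
\<close>

lemma extend_list:
  fixes \<phi> :: "'b \<Rightarrow> 'a"
  assumes FE: "\<And>e. e \<in> FE \<Longrightarrow> e \<noteq> {}"
  shows "placed FE \<phi> P1 P2 (k + (\<Sum>C\<leftarrow>Cs. card C - 1)) \<Longrightarrow>
    (\<And>C. C \<in> set Cs \<Longrightarrow> separated FE C \<and> C \<inter> (P1 \<union> P2) = {} \<and> (\<exists>par h. tree_order FE C (card C - 1) par h)) \<Longrightarrow>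
    sorted_wrt (\<lambda>A B. A \<inter> B = {}) Cs \<Longrightarrow>
    d + c + 1 = k + (\<Sum>C\<leftarrow>Cs. card C - 1) + card P1 + card P2 \<Longrightarrow>
    c + length Cs \<le> card P1 \<Longrightarrow> c + length Cs \<le> k \<Longrightarrow>
    \<exists>\<phi>'. placed FE \<phi>' P1 (P2 \<union> \<Union> (set Cs)) k"
proof (induction Cs arbitrary: \<phi> P2 c)
  case Nil
  then show ?case by auto
next
  case (Cons C Cs)
  let ?t = "card C - 1" and ?l = "k + (\<Sum>C\<leftarrow>Cs. card C - 1)"
  have g: "placed FE \<phi> P1 P2 (?l + ?t)" using Cons.prems(1) by (simp add: algebra_simps)
  obtain par h where C: "tree_order FE C ?t par h" "separated FE C" "C \<inter> (P1 \<union> P2) = {}"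
    using Cons.prems(2)[of C] by auto
  note cC = tree_order_card[OF C(1)]
  have fin: "finite P1" "finite P2" "P1 \<inter> P2 = {}" using g unfolding placed_def by auto
  have cP: "card (P1 \<union> P2) = card P1 + card P2" using fin by (rule card_Un_disjoint)
  have sum: "(\<Sum>C\<leftarrow>C # Cs. card C - 1) = ?t + (\<Sum>C\<leftarrow>Cs. card C - 1)" by simp
  have d: "d + c + 1 = ?l + ?t + card P1 + card P2" using Cons.prems(4) sum by linarith
  have len: "c + 1 + length Cs \<le> card P1" "c + 1 + length Cs \<le> k" using Cons.prems(5,6) by simp_all
  have deg2: "?l + ?t + card P2 \<le> d" using d len(1) by linarith
  have room: "?t + card (P1 \<union> P2) \<le> d" using d len(2) unfolding cP by linarith
  obtain \<phi>' where \<phi>': "placed FE \<phi>' P1 (P2 \<union> C) ?l"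
    using extend_tree[OF g C FE deg2 room] by blast
  have "\<exists>\<phi>''. placed FE \<phi>'' P1 ((P2 \<union> C) \<union> \<Union> (set Cs)) k"
  proof (rule Cons.IH[of _ "P2 \<union> C" "c + 1", OF \<phi>'])
    show "separated FE B \<and> B \<inter> (P1 \<union> (P2 \<union> C)) = {} \<and> (\<exists>par h. tree_order FE B (card B - 1) par h)"
      if B: "B \<in> set Cs" for B
    proof -
      have "C \<inter> B = {}" using Cons.prems(3) B by simp
      then show ?thesis using Cons.prems(2)[of B] B by auto
    qed
    show "sorted_wrt (\<lambda>A B. A \<inter> B = {}) Cs" using Cons.prems(3) by simp
    have "card (P2 \<union> C) = card P2 + card C" using fin(2) cC(2) C(3) by (intro card_Un_disjoint) auto
    then show "d + (c + 1) + 1 = ?l + card P1 + card (P2 \<union> C)" using d cC(1) by linarith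
  qed (use len in auto)
  then show ?case by (simp add: Un_assoc)
qed

lemma placed_empty:
  assumes "\<And>e. e \<in> FE \<Longrightarrow> e \<noteq> {}" shows "placed FE \<phi> {} {} l"
  using assms unfolding placed_def image_edges_def separated_def by auto

lemma extend_isolated:
  fixes \<phi> :: "'b \<Rightarrow> 'a"
  assumes g: "placed FE \<phi> {} P l" and W: "P \<subseteq> W" "finite W" "card W \<le> card V"
    and iso: "\<And>e. e \<in> FE \<Longrightarrow> e \<subseteq> W \<Longrightarrow> e \<subseteq> P" and sep: "separated FE W"
  shows "\<exists>\<phi>'. placed FE \<phi>' {} W l"
proof -
  have ginj: "inj_on \<phi> P" and gV: "\<phi> ` P \<subseteq> V" and gE: "image_edges FE P \<phi> \<subseteq> E"
    and gpair: "\<And>u v. {u, v} \<in> FE \<Longrightarrow> {u, v} \<subseteq> P \<Longrightarrow> inseparable (E - image_edges FE P \<phi>) l (\<phi> u) (\<phi> v)"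
    using g unfolding placed_def by simp_all
  have finP: "finite P" using W finite_subset by blast
  have "card (W - P) \<le> card (V - \<phi> ` P)"
    using W finP finV gV card_image[OF ginj] by (simp add: card_Diff_subset)
  then obtain f where f: "f ` (W - P) \<subseteq> V - \<phi> ` P" "inj_on f (W - P)"
    using card_le_inj[of "W - P" "V - \<phi> ` P"] W finV by auto
  define \<phi>' where "\<phi>' x = (if x \<in> P then \<phi> x else f x)" for x
  have WP: "{e \<in> FE. e \<subseteq> W} = {e \<in> FE. e \<subseteq> P}" using iso W(1) by blast
  have img: "image_edges FE W \<phi>' = image_edges FE P \<phi>"
    unfolding image_edges_def WP
  proof (rule image_cong)
    fix e assume "e \<in> {e \<in> FE. e \<subseteq> P}"
    then show "\<phi>' ` e = \<phi> ` e" unfolding \<phi>'_def by (intro image_cong) auto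
  qed simp
  have p1: "\<phi>' ` P = \<phi> ` P" unfolding \<phi>'_def by (intro image_cong) auto
  have p2: "\<phi>' ` (W - P) = f ` (W - P)" unfolding \<phi>'_def by (intro image_cong) auto
  have i1: "inj_on \<phi>' P" using ginj unfolding \<phi>'_def inj_on_def by simp
  have i2: "inj_on \<phi>' (W - P)" using f(2) unfolding \<phi>'_def inj_on_def by simp
  have "inj_on \<phi>' (P \<union> (W - P))" using i1 i2 p1 p2 f(1) inj_on_Un[of \<phi>' P "W - P"] by blast
  moreover have "P \<union> (W - P) = W" using W(1) by blast
  ultimately have inj: "inj_on \<phi>' W" by simp
  have "\<phi>' ` W = \<phi>' ` P \<union> \<phi>' ` (W - P)" using W(1) by blast
  then have im: "\<phi>' ` W \<subseteq> V" unfolding p1 p2 using gV f(1) by blast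
  have "inseparable (E - image_edges FE W \<phi>') l (\<phi>' u) (\<phi>' v)" if uv: "{u, v} \<in> FE" "{u, v} \<subseteq> W" for u v
  proof -
    have P: "{u, v} \<subseteq> P" using iso[OF uv] .
    then have "\<phi>' u = \<phi> u" "\<phi>' v = \<phi> v" unfolding \<phi>'_def by auto
    then show ?thesis using gpair[OF uv(1) P] img by simp
  qed
  then have "placed FE \<phi>' {} W l"
    unfolding placed_def using W(2) sep inj im gE img by (simp add: separated_def)
  then show ?thesis by blast
qed

text \<open>
  Because of the decreasing order, the first component has enough edges for \<open>extend_list\<close> unless there
  are four components with one edge each.
\<close>

lemma nontrivial_trees:
  fixes FE :: "'b set set"
  assumes FE: "\<And>e. e \<in> FE \<Longrightarrow> e \<noteq> {}"
    and comps: "\<And>C. C \<in> set Ns \<Longrightarrow> separated FE C \<and> (\<exists>par h. tree_order FE C (card C - 1) par h)"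
    and disj: "sorted_wrt (\<lambda>A B. A \<inter> B = {}) Ns" and desc: "sorted_wrt (\<lambda>A B. card B \<le> card A) Ns"
    and two: "\<And>C. C \<in> set Ns \<Longrightarrow> 2 \<le> card C"
    and len: "length Ns \<le> 4" "length Ns \<le> k + 1"
    and d: "d = k + (\<Sum>C\<leftarrow>Ns. card C - 1)"
  shows "\<exists>\<phi> :: 'b \<Rightarrow> 'a. placed FE \<phi> {} (\<Union> (set Ns)) k"
proof (cases Ns)
  case Nil
  then show ?thesis using placed_empty[OF FE] by auto
next
  case (Cons C R)
  let ?t = "card C - 1" and ?l = "k + (\<Sum>C\<leftarrow>R. card C - 1)"
  have dl: "d = ?l + ?t" using d Cons by simp
  have cC: "2 \<le> card C" using two Cons by simp
  obtain par h where C: "tree_order FE C ?t par h" "separated FE C" using comps[of C] Cons by auto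
  have g0: "placed FE (undefined :: 'b \<Rightarrow> 'a) {} {} (?l + ?t)" by (rule placed_empty) (rule FE)
  obtain \<phi> :: "'b \<Rightarrow> 'a" where \<phi>: "placed FE \<phi> {} ({} \<union> C) ?l"
    "\<forall>u \<in> C. \<forall>v \<in> C. inseparable (E - image_edges FE ({} \<union> {} \<union> C) \<phi>) ?l (\<phi> u) (\<phi> v)"
    using extend_tree[OF g0 C _ FE] dl by auto
  have g: "placed FE \<phi> C {} ?l"
    using \<phi> unfolding placed_def by (simp add: separated_def)
  have R: "separated FE B \<and> B \<inter> (C \<union> {}) = {} \<and> (\<exists>par h. tree_order FE B (card B - 1) par h)"
    if "B \<in> set R" for B
  proof -
    have "C \<inter> B = {}" using disj that Cons by simp
    then show ?thesis using comps[of B] that Cons by auto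
  qed
  have disjR: "sorted_wrt (\<lambda>A B. A \<inter> B = {}) R" using disj Cons by simp
  show ?thesis
  proof (cases "length R \<le> card C")
    case True
    have "\<exists>\<phi>'. placed FE \<phi>' C ({} \<union> \<Union> (set R)) k"
    proof (rule extend_list[OF FE g R disjR])
      show "d + 0 + 1 = ?l + card C + card {}" using dl cC by simp
    qed (use True len Cons in auto)
    then obtain \<phi>' where "placed FE \<phi>' C (\<Union> (set R)) k" by auto
    then show ?thesis using placed_merge[of FE \<phi>' C] Cons by auto
  next
    case False
    then have C2: "card C = 2" "length R = 3" using cC len Cons by auto
    then obtain A B D where ABD: "R = [A, B, D]" by (auto simp: numeral_3_eq_3 length_Suc_conv)
    have "card A = 2" "card B = 2" "card D = 2"
      using desc two ABD C2(1) Cons by (auto intro: antisym)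
    note two' = this
    have l: "?l = k + 3" using two' ABD by simp
    have k3: "3 \<le> k" using len(2) Cons C2 by simp
    have d4: "d = k + 4" using dl l C2 by simp
    \<comment> \<open>Two more edges are placed with \<open>extend_list\<close>, keeping one unit of inseparability for the last edge.\<close>
    have "\<exists>\<phi>'. placed FE \<phi>' C ({} \<union> \<Union> (set [A, B])) (k + 1)"
    proof (rule extend_list[OF FE])
      show "placed FE \<phi> C {} (k + 1 + (\<Sum>C\<leftarrow>[A, B]. card C - 1))"
        using g unfolding l using two' by (simp add: numeral_3_eq_3)
      show "d + 0 + 1 = k + 1 + (\<Sum>C\<leftarrow>[A, B]. card C - 1) + card C + card {}"
        using d4 two' C2 by simp
      show "separated FE X \<and> X \<inter> (C \<union> {}) = {} \<and> (\<exists>par h. tree_order FE X (card X - 1) par h)"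
        if "X \<in> set [A, B]" for X using R[of X] that ABD by auto
      show "sorted_wrt (\<lambda>A B. A \<inter> B = {}) [A, B]" using disjR ABD by simp
    qed (use C2 k3 in auto)
    then obtain \<phi>' where g': "placed FE \<phi>' C (A \<union> B) (k + 1)" by auto
    obtain par' h' where D: "tree_order FE D 1 par' h'" "separated FE D"
      using R[of D] ABD two' by auto
    have DC: "D \<inter> (C \<union> (A \<union> B)) = {}" using R[of D] disjR ABD by auto
    have fin: "finite A" "finite B" "finite C" using two' C2 by (auto intro: card_ge_0_finite)
    have AB: "card (A \<union> B) = 4" using disjR ABD fin two' by (simp add: card_Un_disjoint)
    have CAB: "card (C \<union> (A \<union> B)) = 6"
    proof -
      have "C \<inter> (A \<union> B) = {}" using R ABD by auto
      then show ?thesis using fin AB C2 by (simp add: card_Un_disjoint)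
    qed
    have "\<exists>\<phi>''. placed FE \<phi>'' C (A \<union> B \<union> D) k"
    proof (rule extend_edge[OF g' D DC FE])
      show "k + card (A \<union> B) \<le> d" using AB d4 by simp
      show "A \<union> B \<noteq> {}" using AB by auto
      show "1 + card (C \<union> (A \<union> B)) \<le> d" using CAB d4 k3 by simp
    qed
    then obtain \<phi>'' where "placed FE \<phi>'' C (A \<union> B \<union> D) k" by blast
    then have "placed FE \<phi>'' {} (C \<union> (A \<union> B \<union> D)) k" by (rule placed_merge)
    moreover have "C \<union> (A \<union> B \<union> D) = \<Union> (set Ns)" using Cons ABD by auto
    ultimately show ?thesis by auto
  qed
qed

text \<open>
  Isolated vertices of the forest come last: they delete no edge, and the graph has more than \<open>d\<close>
  vertices, which is enough for the whole forest.
\<close>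

theorem forest_embedding:
  fixes FE :: "'b set set"
  assumes FE: "\<And>e. e \<in> FE \<Longrightarrow> e \<noteq> {}"
    and comps: "\<And>C. C \<in> set Cs \<Longrightarrow> separated FE C \<and> (\<exists>par h. tree_order FE C (card C - 1) par h)"
    and disj: "sorted_wrt (\<lambda>A B. A \<inter> B = {}) Cs" and desc: "sorted_wrt (\<lambda>A B. card B \<le> card A) Cs"
    and len: "length Cs \<le> 4" "length Cs \<le> k + 1"
    and d: "d = k + (\<Sum>C\<leftarrow>Cs. card C - 1)"
  shows "\<exists>\<phi> :: 'b \<Rightarrow> 'a. placed FE \<phi> {} (\<Union> (set Cs)) k"
proof -
  define Ns where "Ns = filter (\<lambda>C. 2 \<le> card C) Cs"
  have sumN: "(\<Sum>C\<leftarrow>Ns. card C - 1) = (\<Sum>C\<leftarrow>Cs. card C - 1)"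
    unfolding Ns_def by (induction Cs) auto
  have setN: "set Ns = {C \<in> set Cs. 2 \<le> card C}" unfolding Ns_def by auto
  have lenN: "length Ns \<le> length Cs" unfolding Ns_def by simp
  obtain \<phi> :: "'b \<Rightarrow> 'a" where \<phi>: "placed FE \<phi> {} (\<Union> (set Ns)) k"
  proof -
    have "\<exists>\<phi> :: 'b \<Rightarrow> 'a. placed FE \<phi> {} (\<Union> (set Ns)) k"
    proof (rule nontrivial_trees[OF FE])
      show "separated FE C \<and> (\<exists>par h. tree_order FE C (card C - 1) par h)" if "C \<in> set Ns" for C
        using comps[of C] that setN by simp
      show "sorted_wrt (\<lambda>A B. A \<inter> B = {}) Ns" "sorted_wrt (\<lambda>A B. card B \<le> card A) Ns"
        using disj desc unfolding Ns_def by (simp_all add: sorted_wrt_filter)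
    qed (use setN lenN len d sumN in auto)
    then show ?thesis using that by blast
  qed
  have card1: "finite C" "1 \<le> card C" if "C \<in> set Cs" for C
    using comps[OF that] tree_order_card by fastforce+
  have finW: "finite (\<Union> (set Cs))" using card1 by auto
  have "card (\<Union> (set Cs)) \<le> (\<Sum>C\<leftarrow>Cs. card C)"
    by (induction Cs) (auto intro: order_trans[OF card_Un_le])
  also have "(\<Sum>C\<leftarrow>Cs. card C) = (\<Sum>C\<leftarrow>Cs. card C - 1) + length Cs"
    using card1(2) by (induction Cs) (auto, fastforce)
  also have "\<dots> \<le> card V" using card_V d len(2) by linarith
  finally have cW: "card (\<Union> (set Cs)) \<le> card V" .
  have "\<exists>\<phi>' :: 'b \<Rightarrow> 'a. placed FE \<phi>' {} (\<Union> (set Cs)) k"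
  proof (rule extend_isolated[OF \<phi> _ finW cW])
    show "\<Union> (set Ns) \<subseteq> \<Union> (set Cs)" using setN by auto
    show "separated FE (\<Union> (set Cs))" using comps unfolding separated_def by blast
    fix e assume e: "e \<in> FE" "e \<subseteq> \<Union> (set Cs)"
    then obtain x C where x: "x \<in> e" "C \<in> set Cs" "x \<in> C" using FE[OF e(1)] by blast
    have eC: "e \<subseteq> C" using comps[OF x(2)] e(1) x unfolding separated_def by blast
    have "2 \<le> card C"
    proof (rule ccontr)
      assume "\<not> 2 \<le> card C"
      then have "card C - 1 = 0" by simp
      then obtain par h where "tree_order FE C 0 par h" using comps[OF x(2)] by auto
      then have "{e \<in> FE. e \<subseteq> C} = {}" unfolding tree_order_def tree_edges_def by simp
      then show False using e(1) eC by blast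
    qed
    then show "e \<subseteq> \<Union> (set Ns)" using setN x(2) eC by blast
  qed
  then show ?thesis .
qed

end

section \<open>Graphs as digraphs\<close>

lemma (in pair_graph) uedges_iff: "{u, v} \<in> uedges G \<longleftrightarrow> (u, v) \<in> parcs G"
proof -
  have "(v, u) \<in> parcs G \<Longrightarrow> (u, v) \<in> parcs G" using arcs_symmetric by blast
  then show ?thesis unfolding uedges_def by (auto simp: doubleton_eq_iff image_iff)
qed

lemma (in pair_graph) uedges_cases:
  assumes "e \<in> uedges G" shows "\<exists>u v. u \<noteq> v \<and> e = {u, v} \<and> u \<in> pverts G \<and> v \<in> pverts G"
proof -
  obtain u v where uv: "(u, v) \<in> parcs G" "e = {u, v}" using assms unfolding uedges_def by auto
  then show ?thesis using no_loops' in_arcsD1 in_arcsD2 by blast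
qed

lemma connected_iff_linked:
  assumes arcs: "arcs_ends H = {(x, y). {x, y} \<in> E - M \<and> x \<notin> S \<and> y \<notin> S}"
    and ends: "arcs_ends H \<subseteq> verts H \<times> verts H"
  shows "connected H \<longleftrightarrow> verts H \<noteq> {} \<and> (\<forall>u \<in> verts H. \<forall>v \<in> verts H. (u, v) \<in> linked E S M)"
proof -
  let ?R = "arcs_ends H"
  have sym: "?R\<^sup>s = ?R" unfolding symcl_def arcs by (auto simp: insert_commute)
  have "(u, v) \<in> rtrancl_on (verts H) ?R \<longleftrightarrow> (u, v) \<in> ?R\<^sup>*" if "u \<in> verts H" for u v
  proof
    assume "(u, v) \<in> rtrancl_on (verts H) ?R"
    then show "(u, v) \<in> ?R\<^sup>*"
      by (induction rule: rtrancl_on_induct) (auto intro: rtrancl_into_rtrancl)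
  next
    assume "(u, v) \<in> ?R\<^sup>*"
    then show "(u, v) \<in> rtrancl_on (verts H) ?R"
    proof (induction rule: rtrancl_induct)
      case base
      then show ?case using that by simp
    next
      case (step y z)
      have "z \<in> verts H" using subsetD[OF ends step(2)] by simp
      with step(3,2) show ?case by (rule rtrancl_on_into_rtrancl_on)
    qed
  qed
  then show ?thesis unfolding connected_conv sym unfolding linked_def arcs by blast
qed

lemma pair_graph_delete_edges:
  assumes "pair_graph G" shows "pair_graph (delete_edges G D)"
proof -
  interpret pair_graph G by fact
  have sym: "(v, u) \<in> parcs G" if "(u, v) \<in> parcs G" for u v using that arcs_symmetric by blast
  have sub: "parcs (delete_edges G D) \<subseteq> parcs G" unfolding delete_edges_def by auto
  show ?thesis
  proof unfold_locales
    show "finite (pverts (delete_edges G D))" unfolding delete_edges_def by simp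
    show "finite (parcs (delete_edges G D))" using sub pair_finite_arcs by (rule finite_subset)
    show "symmetric (with_proj (delete_edges G D))"
      unfolding symmetric_def by (auto simp: sym_def delete_edges_def insert_commute intro: sym)
  qed (use no_loops in \<open>auto simp: delete_edges_def dest: in_arcsD1 in_arcsD2\<close>)
qed

lemma uedges_delete_edges:
  assumes "pair_graph G" shows "uedges (delete_edges G D) = uedges G - D"
  unfolding uedges_def delete_edges_def by (auto simp: image_iff)

lemma pverts_delete_edges [simp]: "pverts (delete_edges G D) = pverts G"
  unfolding delete_edges_def by simp

lemma connected_delete_verts_iff:
  assumes "pair_graph G" "S \<subseteq> pverts G"
  shows "connected (with_proj G \<restriction> (pverts G - S)) \<longleftrightarrow> pverts G - S \<noteq> {} \<and>
    (\<forall>u \<in> pverts G - S. \<forall>v \<in> pverts G - S. (u, v) \<in> linked (uedges G) S {})"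
proof -
  interpret pair_graph G by fact
  have arcs: "arcs_ends (with_proj G \<restriction> (pverts G - S)) = {(x, y). {x, y} \<in> uedges G - {} \<and> x \<notin> S \<and> y \<notin> S}"
    unfolding arcs_ends_conv by (auto simp: uedges_iff dest: in_arcsD1 in_arcsD2)
  have ends: "arcs_ends (with_proj G \<restriction> (pverts G - S)) \<subseteq>
      verts (with_proj G \<restriction> (pverts G - S)) \<times> verts (with_proj G \<restriction> (pverts G - S))"
    unfolding arcs_ends_conv by auto
  show ?thesis using connected_iff_linked[OF arcs ends] by (simp only: induce_subgraph_verts)
qed

lemma connected_delete_edges_iff:
  assumes "pair_graph G"
  shows "connected (delete_edges G D) \<longleftrightarrow> pverts G \<noteq> {} \<and>
    (\<forall>u \<in> pverts G. \<forall>v \<in> pverts G. (u, v) \<in> linked (uedges G) {} D)"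
proof -
  interpret pair_graph G by fact
  have arcs: "arcs_ends (delete_edges G D) = {(x, y). {x, y} \<in> uedges G - D \<and> x \<notin> {} \<and> y \<notin> {}}"
    unfolding delete_edges_def by (auto simp: uedges_iff)
  have ends: "arcs_ends (delete_edges G D) \<subseteq> verts (delete_edges G D) \<times> verts (delete_edges G D)"
    unfolding delete_edges_def by (auto dest: in_arcsD1 in_arcsD2)
  show ?thesis using connected_iff_linked[OF arcs ends] by simp
qed

section \<open>Forests as digraphs\<close>

lemma tree_growth:
  fixes FE :: "'b set set"
  assumes C: "finite C" "C \<noteq> {}" and sep: "separated FE C"
    and conn: "\<And>u v. u \<in> C \<Longrightarrow> v \<in> C \<Longrightarrow> (u, v) \<in> linked FE {} {}"
  shows "s < card C \<Longrightarrow> \<exists>par h. inj_on h {..s} \<and> h ` {..s} \<subseteq> C \<and>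
    (\<forall>i. 1 \<le> i \<longrightarrow> i \<le> s \<longrightarrow> par i < i \<and> {h i, h (par i)} \<in> FE)"
proof (induction s)
  case 0
  obtain c where "c \<in> C" using C(2) by blast
  then show ?case by (intro exI[of _ "\<lambda>_. 0"] exI[of _ "\<lambda>_. c"]) auto
next
  case (Suc s)
  then obtain par :: "nat \<Rightarrow> nat" and h where h: "inj_on h {..s}" "h ` {..s} \<subseteq> C"
    "\<And>i. 1 \<le> i \<Longrightarrow> i \<le> s \<Longrightarrow> par i < i \<and> {h i, h (par i)} \<in> FE" by auto
  let ?I = "h ` {..s}"
  have "card ?I = Suc s" using h(1) by (simp add: card_image)
  then have "?I \<noteq> C" using Suc.prems by auto
  then obtain c where c: "c \<in> C" "c \<notin> ?I" using h(2) by blast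
  have "\<exists>x \<in> ?I. \<exists>y. y \<in> C - ?I \<and> {x, y} \<in> FE"
  proof (rule ccontr)
    assume no: "\<not> ?thesis"
    have "h 0 \<in> C" using h(2) by auto
    then have "(h 0, c) \<in> {(x, y). {x, y} \<in> FE}\<^sup>*"
      using conn[OF _ c(1)] unfolding linked_def by simp
    then have "c \<in> ?I"
    proof (induction rule: rtrancl_induct)
      case (step y z)
      have "{y, z} \<in> FE" using step(2) by simp
      then have "{y, z} \<subseteq> C \<or> {y, z} \<inter> C = {}"
        by (rule bspec[OF sep[unfolded separated_def]])
      moreover have "y \<in> C" using step(3) h(2) by (rule rev_subsetD)
      ultimately have "z \<in> C" by simp
      then show ?case using no step(2,3) by auto
    qed auto
    then show False using c(2) by simp
  qed
  then obtain j y where y: "j \<le> s" "y \<in> C" "y \<notin> ?I" "{h j, y} \<in> FE" by auto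
  let ?h = "h(Suc s := y)" and ?par = "par(Suc s := j)"
  have ls: "{..Suc s} = insert (Suc s) {..s}" by auto
  have im: "?h ` {..s} = ?I" by (intro image_cong) auto
  have "inj_on ?h {..s}" using h(1) by (simp add: inj_on_def)
  then have "inj_on ?h {..Suc s}" using y(3) im unfolding ls by auto
  moreover have "?h ` {..Suc s} \<subseteq> C"
  proof -
    have "?h ` {..Suc s} = insert y (?h ` {..s})" unfolding ls image_insert by simp
    then show ?thesis unfolding im using h(2) y(2) by simp
  qed
  moreover have "?par i < i \<and> {?h i, ?h (?par i)} \<in> FE" if "1 \<le> i" "i \<le> Suc s" for i
  proof (cases "i = Suc s")
    case True
    then show ?thesis using y(1,4) by (simp add: insert_commute)
  next
    case False
    then have i: "i \<le> s" using that by simp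
    then have "par i < i" "{h i, h (par i)} \<in> FE" using h(3)[OF that(1)] by auto
    then show ?thesis using i False by simp
  qed
  ultimately show ?case by blast
qed

text \<open>
  Growing a connected component vertex by vertex yields a parent function. An edge that does not join
  a vertex to its parent would be no bridge, since its ends are joined through the root.
\<close>

lemma tree_order_exists:
  fixes FE :: "'b set set"
  assumes C: "finite C" "C \<noteq> {}" and sep: "separated FE C"
    and conn: "\<And>u v. u \<in> C \<Longrightarrow> v \<in> C \<Longrightarrow> (u, v) \<in> linked FE {} {}"
    and edges: "\<And>e. e \<in> FE \<Longrightarrow> \<exists>u v. u \<noteq> v \<and> e = {u, v}"
    and bridge: "\<And>u v. u \<noteq> v \<Longrightarrow> {u, v} \<in> FE \<Longrightarrow> (u, v) \<notin> linked FE {} {{u, v}}"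
  shows "\<exists>par h. tree_order FE C (card C - 1) par h"
proof -
  let ?t = "card C - 1"
  have cC: "0 < card C" using C by (simp add: card_gt_0_iff)
  then have "?t < card C" by simp
  from tree_growth[OF C sep conn this] obtain par :: "nat \<Rightarrow> nat" and h where
    h: "inj_on h {..?t}" "h ` {..?t} \<subseteq> C"
    "\<And>i. 1 \<le> i \<Longrightarrow> i \<le> ?t \<Longrightarrow> par i < i \<and> {h i, h (par i)} \<in> FE" by blast
  have "card (h ` {..?t}) = card C" using h(1) cC by (simp add: card_image)
  then have im: "h ` {..?t} = C" using card_subset_eq[OF C(1) h(2)] by simp
  have "{e \<in> FE. e \<subseteq> C} = tree_edges ?t par h"
  proof
    show "tree_edges ?t par h \<subseteq> {e \<in> FE. e \<subseteq> C}"
    proof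
      fix e assume "e \<in> tree_edges ?t par h"
      then obtain i where i: "1 \<le> i" "i \<le> ?t" "e = {h i, h (par i)}"
        unfolding tree_edges_def by auto
      then have "par i \<le> ?t" "e \<in> FE" using h(3)[of i] by auto
      then show "e \<in> {e \<in> FE. e \<subseteq> C}" using i h(2) by auto
    qed
    show "{e \<in> FE. e \<subseteq> C} \<subseteq> tree_edges ?t par h"
    proof (rule ccontr)
      assume "\<not> ?thesis"
      then obtain e where e: "e \<in> FE" "e \<subseteq> C" "e \<notin> tree_edges ?t par h" by blast
      obtain u v where uv: "u \<noteq> v" "e = {u, v}" using edges[OF e(1)] by blast
      have root: "(h 0, h i) \<in> linked FE {} {e}" if "i \<le> ?t" for i
        using that
      proof (induction i rule: less_induct)
        case (less i)
        show ?case
        proof (cases "i = 0")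
          case True
          then show ?thesis by (simp add: linked_def)
        next
          case False
          then have p: "par i < i" "{h (par i), h i} \<in> FE"
            using h(3)[of i] less.prems by (auto simp: insert_commute)
          have "{h (par i), h i} \<noteq> e"
            using e(3) False less.prems unfolding tree_edges_def by (auto simp: insert_commute)
          then have "(h (par i), h i) \<in> linked FE {} {e}" using p(2) by (intro linked_edge) auto
          moreover have "(h 0, h (par i)) \<in> linked FE {} {e}" using less.IH[OF p(1)] p(1) less.prems by simp
          ultimately show ?thesis by (rule linked_trans[rotated])
        qed
      qed
      have "u \<in> h ` {..?t}" "v \<in> h ` {..?t}" using e(2) uv(2) im by auto
      then have "(h 0, u) \<in> linked FE {} {e}" "(h 0, v) \<in> linked FE {} {e}" using root by auto
      then have "(u, v) \<in> linked FE {} {e}" using linked_sym linked_trans by metis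
      then show False using bridge[OF uv(1)] e(1) uv(2) by simp
    qed
  qed
  then show ?thesis
    using h im unfolding tree_order_def bij_betw_def by blast
qed

text \<open>
  A path between the ends of an edge that avoids this edge has at least two arcs, and together with
  the arc back it is a cycle of length at least three.
\<close>

lemma forest_bridge:
  assumes F: "undirected_forest F" and uv: "u \<noteq> v" "{u, v} \<in> uedges F"
  shows "(u, v) \<notin> linked (uedges F) {} {{u, v}}"
proof
  assume l: "(u, v) \<in> linked (uedges F) {} {{u, v}}"
  interpret pair_graph F using F unfolding undirected_forest_def by simp
  define F0 where "F0 = delete_edges F {{u, v}}"
  interpret F0: pair_graph F0 unfolding F0_def by (rule pair_graph_delete_edges) (rule pair_graph)
  have arcs: "(u, v) \<in> parcs F" using uv(2) by (simp add: uedges_iff)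
  then have rev_arc: "(v, u) \<in> parcs F" using arcs_symmetric by blast
  have F0arcs: "parcs F0 = {(x, y). {x, y} \<in> uedges F - {{u, v}} \<and> x \<notin> {} \<and> y \<notin> {}}"
    unfolding F0_def delete_edges_def by (auto simp: uedges_iff)
  have F0v: "pverts F0 = pverts F" unfolding F0_def by simp
  have "(u, v) \<in> (parcs F0)\<^sup>*" using l unfolding linked_def F0arcs .
  then have "(u, v) \<in> rtrancl_on (pverts F0) (parcs F0)"
  proof (induction rule: rtrancl_induct)
    case base
    then show ?case using arcs in_arcsD1 F0v by auto
  next
    case (step y z)
    have "z \<in> pverts F0" using step(2) F0.in_arcsD2 by blast
    with step(3,2) show ?case by (rule rtrancl_on_into_rtrancl_on)
  qed
  then have "reachable F0 u v" unfolding reachable_def by simp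
  then obtain p where p: "F0.apath u p v" unfolding F0.reachable_apath by blast
  then have w: "F0.awalk u p v" and d: "distinct (pawalk_verts u p)"
    unfolding F0.apath_def by simp_all
  have set: "set p \<subseteq> parcs F0" and cas: "pcas u p v" using w unfolding F0.awalk_def by simp_all
  have sub: "parcs F0 \<subseteq> parcs F" unfolding F0_def delete_edges_def by auto
  have aw: "awalk u p v" using w sub unfolding F0.awalk_def awalk_def F0v by auto
  have aw2: "awalk v [(v, u)] u" using rev_arc in_arcsD1 in_arcsD2 by (auto simp: awalk_simps)
  have cyc: "awalk u (p @ [(v, u)]) u" using aw aw2 by auto
  have verts: "awalk_verts u (p @ [(v, u)]) = awalk_verts u p @ [u]"
    using awalk_verts_append[OF cyc] aw by simp
  obtain vs where vs: "awalk_verts u p = u # vs" using aw by (cases p) auto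
  have "distinct (tl (awalk_verts u (p @ [(v, u)])))"
    unfolding verts using d vs by simp
  then have "cycle (p @ [(v, u)])" unfolding cycle_def using cyc by blast
  moreover have "3 \<le> length (p @ [(v, u)])"
  proof (rule ccontr)
    assume "\<not> ?thesis"
    then have "length p \<le> 1" by simp
    then consider "p = []" | e where "p = [e]" by (cases p) auto
    then show False
    proof cases
      case 1
      then show ?thesis using cas uv(1) by simp
    next
      case 2
      then have "e = (u, v)" using cas by (cases e) auto
      then show ?thesis using set 2 F0arcs by auto
    qed
  qed
  ultimately show False using F unfolding undirected_forest_def by blast
qed

lemma sorted_disjoint_list:
  fixes \<C> :: "'b set set"
  assumes "finite \<C>" "\<And>A B. A \<in> \<C> \<Longrightarrow> B \<in> \<C> \<Longrightarrow> A \<noteq> B \<Longrightarrow> A \<inter> B = {}"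
  shows "\<exists>Cs. set Cs = \<C> \<and> length Cs = card \<C> \<and> sorted_wrt (\<lambda>A B. A \<inter> B = {}) Cs \<and>
    sorted_wrt (\<lambda>A B. card B \<le> card A) Cs"
proof -
  obtain xs where xs: "set xs = \<C>" "distinct xs" using finite_distinct_list[OF assms(1)] by blast
  define Cs where "Cs = rev (sort_key card xs)"
  have set: "set Cs = \<C>" and dist: "distinct Cs" unfolding Cs_def using xs by simp_all
  have "sorted (map card (sort_key card xs))" by simp
  then have "sorted_wrt (\<lambda>A B. card B \<le> card A) Cs"
    unfolding Cs_def sorted_wrt_rev by (simp add: sorted_wrt_map)
  moreover have "sorted_wrt (\<lambda>A B. A \<inter> B = {}) Cs"
    unfolding sorted_wrt_iff_nth_less
  proof (intro allI impI)
    fix i j assume ij: "i < j" "j < length Cs"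
    then have "Cs ! i \<noteq> Cs ! j" using dist by (simp add: nth_eq_iff_index_eq)
    then show "Cs ! i \<inter> Cs ! j = {}" using ij set by (intro assms(2)) (auto simp: set[symmetric])
  qed
  moreover have "length Cs = card \<C>" using set dist distinct_card by metis
  ultimately show ?thesis using set by blast
qed

lemma forest_components:
  assumes F: "undirected_forest F"
  shows "\<exists>Cs. \<Union> (set Cs) = pverts F \<and> length Cs = num_components F \<and>
    (\<forall>C \<in> set Cs. separated (uedges F) C \<and> (\<exists>par h. tree_order (uedges F) C (card C - 1) par h)) \<and>
    sorted_wrt (\<lambda>A B. A \<inter> B = {}) Cs \<and> sorted_wrt (\<lambda>A B. card B \<le> card A) Cs"
proof -
  interpret pair_graph F using F unfolding undirected_forest_def by simp
  have "\<exists>Cs. set Cs = sccs_verts \<and> length Cs = card sccs_verts \<and> sorted_wrt (\<lambda>A B. A \<inter> B = {}) Cs \<and>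
    sorted_wrt (\<lambda>A B. card B \<le> card A) Cs"
    using finite_sccs_verts sccs_verts_disjoint by (intro sorted_disjoint_list) auto
  then obtain Cs where Cs: "set Cs = sccs_verts" "length Cs = card sccs_verts"
    "sorted_wrt (\<lambda>A B. A \<inter> B = {}) Cs" "sorted_wrt (\<lambda>A B. card B \<le> card A) Cs" by blast
  have cover: "\<Union> (set Cs) = pverts F"
  proof
    show "\<Union> (set Cs) \<subseteq> pverts F" using sccs_verts_subsets Cs(1) by auto
    show "pverts F \<subseteq> \<Union> (set Cs)"
    proof
      fix v assume "v \<in> pverts F"
      then have "v \<in> scc_of v" "scc_of v \<in> sccs_verts" using in_scc_of_self scc_of_in_sccs_verts by auto
      then show "v \<in> \<Union> (set Cs)" using Cs(1) by blast
    qed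
  qed
  have len: "length Cs = num_components F"
    unfolding num_components_def Cs(2) by (rule card_sccs_verts)
  have comp: "separated (uedges F) C \<and> (\<exists>par h. tree_order (uedges F) C (card C - 1) par h)"
    if C: "C \<in> set Cs" for C
  proof -
    have CS: "C \<in> sccs_verts" using C Cs(1) by simp
    have CP: "C \<subseteq> pverts F" using C cover by blast
    have fin: "finite C" using CP pair_finite_verts by (rule finite_subset)
    have ne: "C \<noteq> {}" using CS unfolding sccs_verts_def by blast
    have step: "y \<in> C" if "(x, y) \<in> parcs F" "x \<in> C" for x y
    proof -
      have "(y, x) \<in> parcs F" using that(1) arcs_symmetric by blast
      then have "reachable F x y" "reachable F y x"
        using that(1) by (auto intro!: reachable_adjI)
      then show ?thesis using CS that(2) unfolding sccs_verts_def by blast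
    qed
    have sep: "separated (uedges F) C"
      unfolding separated_def
    proof
      fix e assume "e \<in> uedges F"
      then obtain x y where xy: "(x, y) \<in> parcs F" "e = {x, y}" unfolding uedges_def by auto
      have "(y, x) \<in> parcs F" using xy(1) arcs_symmetric by blast
      then show "e \<subseteq> C \<or> e \<inter> C = {}" using step[OF xy(1)] step[of y x] xy(2) by auto
    qed
    have conn: "(x, y) \<in> linked (uedges F) {} {}" if xy: "x \<in> C" "y \<in> C" for x y
    proof -
      have "reachable F x y" using CS xy unfolding sccs_verts_def by blast
      then have "(x, y) \<in> rtrancl_on (pverts F) (parcs F)" unfolding reachable_def by simp
      then have "(x, y) \<in> (parcs F)\<^sup>*"
        by (induction rule: rtrancl_on_induct) (auto intro: rtrancl_into_rtrancl)
      moreover have "{(x, y). {x, y} \<in> uedges F - {} \<and> x \<notin> {} \<and> y \<notin> {}} = parcs F"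
        by (auto simp: uedges_iff)
      ultimately show ?thesis unfolding linked_def by simp
    qed
    have "\<exists>par h. tree_order (uedges F) C (card C - 1) par h"
      by (rule tree_order_exists[OF fin ne sep conn _ forest_bridge[OF F]]) (use uedges_cases in blast)+
    then show ?thesis using sep by blast
  qed
  show ?thesis using cover len comp Cs(3,4) by blast
qed

lemma sum_list_components:
  assumes "sorted_wrt (\<lambda>A B. A \<inter> B = {}) Cs" "\<And>C. C \<in> set Cs \<Longrightarrow> finite C \<and> 1 \<le> card C"
  shows "(\<Sum>C\<leftarrow>Cs. card C - 1) + length Cs = card (\<Union> (set Cs))"
  using assms
proof (induction Cs)
  case (Cons C Cs)
  have "C \<inter> \<Union> (set Cs) = {}" using Cons.prems(1) by auto
  moreover have "finite (\<Union> (set Cs))" "finite C" "1 \<le> card C" using Cons.prems(2) by auto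
  ultimately have "card (\<Union> (set (C # Cs))) = card C + card (\<Union> (set Cs))"
    by (simp add: card_Un_disjoint)
  moreover have "(\<Sum>C\<leftarrow>Cs. card C - 1) + length Cs = card (\<Union> (set Cs))"
    using Cons by simp
  ultimately show ?case using \<open>1 \<le> card C\<close> by simp
qed simp

definition image_graph :: "('b \<Rightarrow> 'a) \<Rightarrow> 'b pair_pre_digraph \<Rightarrow> 'a pair_pre_digraph" where
  "image_graph \<phi> F = \<lparr>pverts = \<phi> ` pverts F, parcs = (\<lambda>(u, v). (\<phi> u, \<phi> v)) ` parcs F\<rparr>"

lemma uedges_image_graph:
  assumes "pair_graph F" shows "uedges (image_graph \<phi> F) = image_edges (uedges F) (pverts F) \<phi>"
proof -
  interpret pair_graph F by fact
  have "{e \<in> uedges F. e \<subseteq> pverts F} = uedges F" using uedges_cases by auto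
  then show ?thesis
    unfolding image_edges_def by (simp add: uedges_def image_graph_def image_image case_prod_unfold)
qed

text \<open>
  The cycles of the image are pulled back along the inverse isomorphism.
\<close>

lemma image_graph_iso:
  fixes \<phi> :: "'b \<Rightarrow> 'a"
  assumes F: "undirected_forest F" and inj: "inj_on \<phi> (pverts F)"
  shows "digraph_iso F (image_graph \<phi> F)" "undirected_forest (image_graph \<phi> F)"
proof -
  interpret pair_graph F using F unfolding undirected_forest_def by simp
  define hom :: "('b, 'b \<times> 'b, 'a, 'a \<times> 'a) digraph_isomorphism" where
    "hom = \<lparr>iso_verts = \<phi>, iso_arcs = (\<lambda>(u, v). (\<phi> u, \<phi> v)), iso_head = snd, iso_tail = fst\<rparr>"
  have hom: "digraph_isomorphism hom"
    unfolding digraph_isomorphism_def hom_def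
    using wf_digraph_axioms inj by (auto simp: inj_on_def dest: in_arcsD1 in_arcsD2)
  have app: "with_proj (image_graph \<phi> F) = app_iso hom (with_proj F)"
    unfolding app_iso_def hom_def image_graph_def with_proj_def by simp
  show "digraph_iso F (image_graph \<phi> F)" unfolding digraph_iso_def using hom app by blast
  have pg: "pair_graph (image_graph \<phi> F)"
  proof unfold_locales
    show "finite (pverts (image_graph \<phi> F))" "finite (parcs (image_graph \<phi> F))"
      unfolding image_graph_def by simp_all
    show "symmetric (with_proj (image_graph \<phi> F))"
      unfolding symmetric_def by (auto simp: sym_def image_graph_def dest: arcs_symmetric intro: rev_image_eqI)
    fix e assume "e \<in> parcs (image_graph \<phi> F)"
    then obtain u v where e: "e = (\<phi> u, \<phi> v)" "(u, v) \<in> parcs F" unfolding image_graph_def by auto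
    have uv: "u \<in> pverts F" "v \<in> pverts F" using e(2) in_arcsD1 in_arcsD2 by auto
    show "fst e \<in> pverts (image_graph \<phi> F)" "snd e \<in> pverts (image_graph \<phi> F)"
      using e uv unfolding image_graph_def by auto
    show "fst e \<noteq> snd e" using e uv no_loops' inj_onD[OF inj, of u v] by auto
  qed
  have "\<not> 3 \<le> length p" if c: "pre_digraph.cycle (image_graph \<phi> F) p" for p
  proof
    assume len: "3 \<le> length p"
    interpret H: pair_graph "image_graph \<phi> F" by (rule pg)
    obtain u where u: "H.awalk u p u" "distinct (tl (H.awalk_verts u p))" "p \<noteq> []"
      using c unfolding H.cycle_def by blast
    let ?i = "inv_iso hom"
    let ?u = "iso_verts ?i u" and ?p = "map (iso_arcs ?i) p"
    have w: "awalk ?u ?p ?u" using awalk_app_isoD[OF _ hom] u(1) unfolding app by blast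
    have uV: "u \<in> verts (app_iso hom F)" using u(1) unfolding app[symmetric] by auto
    have sp: "set p \<subseteq> arcs (app_iso hom F)" using u(1) unfolding app[symmetric] by (auto simp: H.awalk_def)
    have pu: "iso_verts hom ?u = u" using hom uV by (rule iso_verts_iso_inv)
    have pp: "map (iso_arcs hom) ?p = p"
    proof -
      have "(iso_arcs hom \<circ> iso_arcs ?i) a = a" if "a \<in> set p" for a
        using iso_arcs_iso_inv[OF hom subsetD[OF sp that]] by simp
      then show ?thesis unfolding map_map by (rule map_idI)
    qed
    have av: "H.awalk_verts u p = map (iso_verts hom) (awalk_verts ?u ?p)"
      using awalk_verts_app_iso_eq[OF hom w] unfolding pu pp app[symmetric] awalk_verts_with_proj_eq .
    then have "distinct (map (iso_verts hom) (tl (awalk_verts ?u ?p)))"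
      using u(2) unfolding av by (simp only: map_tl)
    then have "distinct (tl (awalk_verts ?u ?p))" by (simp add: distinct_map)
    then have "cycle ?p" unfolding cycle_def using w u(3) by blast
    then show False using F len unfolding undirected_forest_def by auto
  qed
  then show "undirected_forest (image_graph \<phi> F)"
    unfolding undirected_forest_def using pg by blast
qed

lemma dense_graph_uedges:
  assumes G: "pair_graph G" and ne: "pverts G \<noteq> {}" and d: "d \<le> min_degree G"
  shows "dense_graph (pverts G) (uedges G) d"
proof -
  interpret pair_graph G by fact
  have neighbours: "neighbours (uedges G) v = {w. (v, w) \<in> parcs G}" for v
    unfolding neighbours_def by (auto simp: uedges_iff)
  show ?thesis
  proof
    show "finite (pverts G)" "pverts G \<noteq> {}" using ne by simp_all
    show "neighbours (uedges G) v \<subseteq> pverts G" "v \<notin> neighbours (uedges G) v" for v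
      unfolding neighbours using no_loops' by (auto dest: in_arcsD2)
    fix v assume v: "v \<in> pverts G"
    have "min_degree G \<le> out_degree G v"
      unfolding min_degree_def using v by (intro Min_le) auto
    also have "out_degree G v = card (neighbours (uedges G) v)"
    proof -
      have "out_arcs G v = Pair v ` neighbours (uedges G) v"
        unfolding neighbours out_arcs_def by auto
      moreover have "inj_on (Pair v) (neighbours (uedges G) v)" by (simp add: inj_on_def)
      ultimately show ?thesis unfolding out_degree_def by (simp add: card_image)
    qed
    finally show "d \<le> card (neighbours (uedges G) v)" using d by simp
  qed
qed

section \<open>Subforests whose removal keeps the connectivity\<close>

theorem theorem1p2:
  fixes G :: "'a pair_pre_digraph" and F :: "'b pair_pre_digraph" and k m \<omega> :: nat
  assumes "1 \<le> k"
    and "pair_graph G"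
    and "undirected_forest F"
    and "card (pverts F) = m"
    and "num_components F = \<omega>"
    and "1 \<le> \<omega>" and "\<omega> \<le> 4"
    and "min_degree G \<ge> k + m - \<omega>"
    and "k \<ge> \<omega> - 1"
  shows "(k_connected k G \<longrightarrow>
            (\<exists>F'. subforest F' G \<and> digraph_iso F F' \<and>
                  k_connected k (delete_edges G (uedges F')))) \<and>
         (k_edge_connected k G \<longrightarrow>
            (\<exists>F'. subforest F' G \<and> digraph_iso F F' \<and>
                  k_edge_connected k (delete_edges G (uedges F'))))"
proof -
  interpret G: pair_graph G by fact
  interpret F: pair_graph F using assms(3) unfolding undirected_forest_def by simp
  obtain Cs where Cs: "\<Union> (set Cs) = pverts F" "length Cs = \<omega>"
    "\<And>C. C \<in> set Cs \<Longrightarrow> separated (uedges F) C \<and> (\<exists>par h. tree_order (uedges F) C (card C - 1) par h)"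
    "sorted_wrt (\<lambda>A B. A \<inter> B = {}) Cs" "sorted_wrt (\<lambda>A B. card B \<le> card A) Cs"
    using forest_components[OF assms(3)] assms(5) by blast
  have "(\<Sum>C\<leftarrow>Cs. card C - 1) + length Cs = card (\<Union> (set Cs))"
  proof (rule sum_list_components[OF Cs(4)])
    fix C assume C: "C \<in> set Cs"
    obtain par h where t: "tree_order (uedges F) C (card C - 1) par h" using Cs(3)[OF C] by blast
    then have "bij_betw h {..card C - 1} C" unfolding tree_order_def by simp
    then have "card C = card {..card C - 1}" "finite C"
      using bij_betw_same_card[of h] bij_betw_finite[of h] by force+
    then show "finite C \<and> 1 \<le> card C" by simp
  qed
  then have sum: "k + m - \<omega> = k + (\<Sum>C\<leftarrow>Cs. card C - 1)" using Cs(1,2) assms(4) by simp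
  have FE: "e \<noteq> {}" if "e \<in> uedges F" for e using F.uedges_cases[OF that] by auto
  have main: "\<exists>F'. subforest F' G \<and> digraph_iso F F' \<and>
      (\<forall>u v. {u, v} \<in> uedges G \<longrightarrow> {u, v} \<notin> uedges G - uedges F' \<longrightarrow> inseparable (uedges G - uedges F') k u v)"
    if ne: "pverts G \<noteq> {}"
  proof -
    interpret dense_graph "pverts G" "uedges G" "k + m - \<omega>"
      using assms(2) ne assms(8) by (rule dense_graph_uedges)
    have "length Cs \<le> 4" "length Cs \<le> k + 1" using Cs(2) assms(7,9) by linarith+
    then obtain \<phi> :: "'b \<Rightarrow> 'a" where \<phi>: "placed (uedges F) \<phi> {} (pverts F) k"
      using forest_embedding[OF FE Cs(3,4,5) _ _ sum] unfolding Cs(1) by blast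
    let ?F = "image_graph \<phi> F"
    have img: "image_edges (uedges F) ({} \<union> pverts F) \<phi> = uedges ?F"
      by (simp add: uedges_image_graph[OF F.pair_graph])
    have inj: "inj_on \<phi> (pverts F)" and im: "\<phi> ` pverts F \<subseteq> pverts G"
      and sub: "uedges ?F \<subseteq> uedges G"
      using \<phi> unfolding placed_def img by simp_all
    have ins: "inseparable (uedges G - uedges ?F) k (\<phi> a) (\<phi> b)" if "{a, b} \<in> uedges F" for a b
    proof -
      have "{a, b} \<subseteq> {} \<union> pverts F"
        using that F.in_arcsD1 F.in_arcsD2 unfolding F.uedges_iff by blast
      then show ?thesis using \<phi> that unfolding placed_def img by blast
    qed
    note iso = image_graph_iso[OF assms(3) inj]
    interpret F': pair_graph ?F using iso(2) unfolding undirected_forest_def by simp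
    have "subgraph ?F G"
    proof (rule subgraphI)
      show "verts ?F \<subseteq> verts G" using im unfolding image_graph_def by simp
      show "arcs ?F \<subseteq> arcs G"
        using sub by (auto simp: G.uedges_iff[symmetric] F'.uedges_iff[symmetric])
      show "compatible G ?F" by (simp add: compatible_def)
    qed (rule F'.wf_digraph_axioms, rule G.wf_digraph_axioms)
    then have "subforest ?F G" unfolding subforest_def using iso(2) by blast
    moreover have "inseparable (uedges G - uedges ?F) k u v"
      if uv: "{u, v} \<in> uedges G" "{u, v} \<notin> uedges G - uedges ?F" for u v
    proof -
      have "(u, v) \<in> parcs ?F" using uv F'.uedges_iff by blast
      then obtain a b where ab: "(a, b) \<in> parcs F" "u = \<phi> a" "v = \<phi> b"
        unfolding image_graph_def by auto
      then show ?thesis using ins[of a b] F.uedges_iff by simp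
    qed
    ultimately show ?thesis using iso(1) by blast
  qed
  show ?thesis
  proof (intro conjI impI)
    assume k: "k_connected k G"
    then have "pverts G \<noteq> {}" unfolding k_connected_def by auto
    then obtain F' where F': "subforest F' G" "digraph_iso F F'"
      "\<And>u v. {u, v} \<in> uedges G \<Longrightarrow> {u, v} \<notin> uedges G - uedges F' \<Longrightarrow> inseparable (uedges G - uedges F') k u v"
      using main by blast
    let ?H = "delete_edges G (uedges F')"
    have H: "pair_graph ?H" using assms(2) by (rule pair_graph_delete_edges)
    have "connected (with_proj ?H \<restriction> (pverts G - S))" if S: "S \<subseteq> pverts G" "card S < k" for S
    proof -
      have finS: "finite S" using S(1) G.pair_finite_verts by (rule finite_subset)
      have tr: "(u, v) \<in> linked (uedges ?H) S {}" if "(u, v) \<in> linked (uedges G) S {}" for u v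
        unfolding uedges_delete_edges[OF assms(2)]
        by (rule linked_transfer[OF F'(3) _ _ _ that]) (use S(2) finS in auto)
      have "connected (with_proj G \<restriction> (pverts G - S))" using k S unfolding k_connected_def by blast
      then have "pverts ?H - S \<noteq> {} \<and>
          (\<forall>u \<in> pverts ?H - S. \<forall>v \<in> pverts ?H - S. (u, v) \<in> linked (uedges ?H) S {})"
        unfolding connected_delete_verts_iff[OF assms(2) S(1)] using tr by simp
      then show ?thesis using connected_delete_verts_iff[OF H, of S] S(1) by simp
    qed
    then have "k_connected k ?H" using k unfolding k_connected_def by simp
    then show "\<exists>F'. subforest F' G \<and> digraph_iso F F' \<and> k_connected k (delete_edges G (uedges F'))"
      using F' by blast
  next
    assume k: "k_edge_connected k G"
    have conn: "connected (delete_edges G D)" if "D \<subseteq> uedges G" "card D < k" for D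
      using k that unfolding k_edge_connected_def by blast
    have "pverts G \<noteq> {}" using conn[of "{}"] assms(1) connected_delete_edges_iff[OF assms(2)] by simp
    then obtain F' where F': "subforest F' G" "digraph_iso F F'"
      "\<And>u v. {u, v} \<in> uedges G \<Longrightarrow> {u, v} \<notin> uedges G - uedges F' \<Longrightarrow> inseparable (uedges G - uedges F') k u v"
      using main by blast
    let ?H = "delete_edges G (uedges F')"
    have H: "pair_graph ?H" using assms(2) by (rule pair_graph_delete_edges)
    have finE: "finite (uedges G)" unfolding uedges_def by simp
    have "connected (delete_edges ?H D)" if D: "D \<subseteq> uedges ?H" "card D < k" for D
    proof -
      have DG: "D \<subseteq> uedges G" using D(1) unfolding uedges_delete_edges[OF assms(2)] by blast
      then have finD: "finite D" using finE by (rule finite_subset)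
      have tr: "(u, v) \<in> linked (uedges ?H) {} D" if "(u, v) \<in> linked (uedges G) {} D" for u v
        unfolding uedges_delete_edges[OF assms(2)]
        by (rule linked_transfer[OF F'(3) _ _ _ that]) (use D(2) finD in auto)
      have "connected (delete_edges G D)" using DG D(2) by (rule conn)
      then show ?thesis
        unfolding connected_delete_edges_iff[OF assms(2)] connected_delete_edges_iff[OF H]
        using tr by simp
    qed
    then have "k_edge_connected k ?H" unfolding k_edge_connected_def by blast
    then show "\<exists>F'. subforest F' G \<and> digraph_iso F F' \<and> k_edge_connected k (delete_edges G (uedges F'))"
      using F' by blast
  qed
qed

end
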